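(* In the exponential model, suppose that $\underline{\alpha}=\underline{\beta}=0$. Then the shape function $g$ satisfies $$g(s,t)=s\,\mathrm E\left[\frac1a\right]+t\,\mathrm E\left[\frac1b\right]\quad\text{for all } s,t>0$$ (as an identity in $[0,\infty]$).
   Context: Let $\mathbb N=\{1,2,\dots\}$. Exponential model: Let $\mathbf a=(a_n)_{n\in\mathbb N}$ and $\mathbf b=(b_n)_{n\in\mathbb N}$ be stationary random sequences with terms in $(0,\infty)$, with joint distribution $\mu$. Let $\tau_k$ denote the shift $(c_n)_{n\in\mathbb N}\mapsto(c_{n+k})_{n\in\mathbb N}$. It is assumed that $\mu$ is totally ergodic: for each $k,l\in\mathbb N$ separately, $\mu$ is (stationary and) ergodic under $\tau_k\times\tau_l$, which acts by $(\mathbf a,\mathbf b)\mapsto(\tau_k\mathbf a,\tau_l\mathbf b)$. Given $(\mathbf a,\mathbf b)$, the weights $\{W(i,j):i,j\in\mathbb N\}$ are independent under the conditional law $\mathbf P_{\mathbf a,\mathbf b}$ with $\mathbf P_{\mathbf a,\mathbf b}(W(i,j)\ge x)=e^{-(a_i+b_j)x}$ for $x\ge0$. Let $\mathbb P(\cdot)=\int\mathbf P_{\mathbf a,\mathbf b}(\cdot)\,\mu(d\mathbf a,d\mathbf b)$ be the unconditional law of the weights. Last-passage times: $G(m,n)=\max_\pi\sum_{(i,j)\in\pi}W(i,j)$, the maximum being over all directed paths $\pi$ from $(1,1)$ to $(m,n)$ in $\mathbb Z^2$ (finite sequences of sites with steps in $\{(1,0),(0,1)\}$). Shape function: $g:(0,\infty)^2\to[0,\infty]$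 is the deterministic function such that, $\mathbb P$-a.s., $\lim_{n\to\infty}n^{-1}G(\lfloor ns\rfloor,\lfloor nt\rfloor)=g(s,t)$ for all $s,t>0$ (such a function exists). Notation: $\alpha$ and $\beta$ are the distributions of $a=a_1$ and $b=b_1$; $\underline{\alpha}$ and $\underline{\beta}$ are the left endpoints of their supports (the essential infima of $a_1$ and $b_1$); $\mathrm E$ is expectation under $\mu$. *)

theory Defs
  imports "HOL-Probability.Probability"
begin

text \<open>
  Sequences over \<open>{1, 2, \<dots>}\<close> are elements of products indexed by \<open>{1..}\<close>, hence
  extensional functions, equal to \<open>undefined\<close> at the index \<open>0\<close>.
\<close>

definition pos_seqs :: "(nat \<Rightarrow> real) measure" where
  "pos_seqs = (\<Pi>\<^sub>M n\<in>{1..}. restrict_space borel {0<..})"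

definition shift :: "nat \<Rightarrow> (nat \<Rightarrow> real) \<Rightarrow> (nat \<Rightarrow> real)" where
  "shift k c = (\<lambda>n\<in>{1..}. c (n + k))"

definition ergodic :: "'a measure \<Rightarrow> ('a \<Rightarrow> 'a) \<Rightarrow> bool" where
  "ergodic M T \<longleftrightarrow>
     T \<in> M \<rightarrow>\<^sub>M M \<and> distr M M T = M \<and>
     (\<forall>A\<in>sets M. T -` A \<inter> space M = A \<longrightarrow> measure M A = 0 \<or> measure M A = 1)"

text \<open>
  The parameter is the joint law of the two sequences. Invariance under the joint shift by
  \<open>(1, 1)\<close> contains the stationarity of each of them.
\<close>

locale exponential_model = prob_space \<mu> for \<mu> :: "((nat \<Rightarrow> real) \<times> (nat \<Rightarrow> real)) measure" +
  assumes sets_joint_law: "sets \<mu> = sets (pos_seqs \<Otimes>\<^sub>M pos_seqs)"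
    and totally_ergodic: "\<And>k l. 1 \<le> k \<Longrightarrow> 1 \<le> l \<Longrightarrow> ergodic \<mu> (map_prod (shift k) (shift l))"

text \<open>The law of the weights given \<open>(a, b)\<close>, and its average over the law of \<open>(a, b)\<close>.\<close>

definition quenched_law :: "(nat \<Rightarrow> real) \<times> (nat \<Rightarrow> real) \<Rightarrow> (nat \<times> nat \<Rightarrow> real) measure" where
  "quenched_law = (\<lambda>(a, b). \<Pi>\<^sub>M (i, j)\<in>{1..} \<times> {1..}.
     density lborel (\<lambda>x. ennreal (exponential_density (a i + b j) x)))"

definition annealed_law ::
    "((nat \<Rightarrow> real) \<times> (nat \<Rightarrow> real)) measure \<Rightarrow> (nat \<times> nat \<Rightarrow> real) measure" where
  "annealed_law \<mu> = \<mu> \<bind> quenched_law"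

definition directed_paths :: "nat \<times> nat \<Rightarrow> nat \<times> nat \<Rightarrow> (nat \<times> nat) list set" where
  "directed_paths p q = {\<pi>. \<pi> \<noteq> [] \<and> hd \<pi> = p \<and> last \<pi> = q \<and>
     successively (\<lambda>(i, j) z. z = (i + 1, j) \<or> z = (i, j + 1)) \<pi>}"

text \<open>Only meaningful for \<open>m, n \<ge> 1\<close>; otherwise there is no path.\<close>

definition last_passage :: "(nat \<times> nat \<Rightarrow> real) \<Rightarrow> nat \<Rightarrow> nat \<Rightarrow> real" where
  "last_passage W m n = Max ((\<lambda>\<pi>. \<Sum>z\<leftarrow>\<pi>. W z) ` directed_paths (1, 1) (m, n))"

text \<open>
  The shape function is determined only on \<open>(0, \<infinity>)\<^sup>2\<close>. The finitely many \<open>n\<close> for which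
  \<open>\<lfloor>n s\<rfloor>\<close> or \<open>\<lfloor>n t\<rfloor>\<close> is \<open>0\<close> do not affect the limit. The weights are almost surely
  nonnegative, so \<^const>\<open>ennreal\<close> does not truncate.
\<close>

definition is_shape_function ::
    "((nat \<Rightarrow> real) \<times> (nat \<Rightarrow> real)) measure \<Rightarrow> (real \<Rightarrow> real \<Rightarrow> ennreal) \<Rightarrow> bool" where
  "is_shape_function \<mu> g \<longleftrightarrow>
     (AE W in annealed_law \<mu>. \<forall>s>0. \<forall>t>0.
        (\<lambda>n. ennreal (last_passage W (nat \<lfloor>real n * s\<rfloor>) (nat \<lfloor>real n * t\<rfloor>) / real n))
          \<longlonglongrightarrow> g s t)"

definition law_a :: "((nat \<Rightarrow> real) \<times> (nat \<Rightarrow> real)) measure \<Rightarrow> real measure" where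
  "law_a \<mu> = distr \<mu> borel (\<lambda>(a, b). a 1)"

definition law_b :: "((nat \<Rightarrow> real) \<times> (nat \<Rightarrow> real)) measure \<Rightarrow> real measure" where
  "law_b \<mu> = distr \<mu> borel (\<lambda>(a, b). b 1)"

definition support :: "real measure \<Rightarrow> real set" where
  "support \<nu> = {x. \<forall>U. open U \<longrightarrow> x \<in> U \<longrightarrow> emeasure \<nu> U > 0}"

definition left_endpoint :: "real measure \<Rightarrow> real" where
  "left_endpoint \<nu> = Inf (support \<nu>)"

text \<open>
  Basic facts showing that the total functions above (\<^const>\<open>bind\<close>, \<^const>\<open>Max\<close>, \<^const>\<open>Inf\<close>)
  are applied within their proper domains.
\<close>

lemma prob_space_weight:
  assumes "(a, b) \<in> space (pos_seqs \<Otimes>\<^sub>M pos_seqs)" "1 \<le> i" "1 \<le> j"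
  shows "prob_space (density lborel (\<lambda>x. ennreal (exponential_density (a i + b j) x)))"
proof -
  have "0 < a i" "0 < b j"
    using assms by (auto simp: space_pair_measure pos_seqs_def space_PiM PiE_def Pi_def space_restrict_space)
  then show ?thesis
    by (intro prob_space_exponential_density) simp
qed

lemma sets_quenched_law:
  "sets (quenched_law ab) = sets (\<Pi>\<^sub>M z\<in>{1..} \<times> {1..}. borel)"
  by (auto simp: quenched_law_def split: prod.splits intro!: sets_PiM_cong)

lemma measurable_rate:
  assumes "1 \<le> i" "1 \<le> j"
  shows "(\<lambda>ab. fst ab i + snd ab j) \<in> borel_measurable (pos_seqs \<Otimes>\<^sub>M pos_seqs)"
proof -
  have *: "(\<lambda>c. c n) \<in> borel_measurable pos_seqs" if "1 \<le> n" for n :: nat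
  proof -
    have "(\<lambda>c. c n) \<in> pos_seqs \<rightarrow>\<^sub>M restrict_space borel {0<..}"
      unfolding pos_seqs_def using that by (intro measurable_component_singleton) simp
    then show ?thesis by (simp add: measurable_restrict_space2_iff)
  qed
  show ?thesis
    using measurable_compose[OF measurable_fst *[OF assms(1)]]
      measurable_compose[OF measurable_snd *[OF assms(2)]]
    by (intro borel_measurable_add)
qed

lemma measurable_quenched_law:
  "quenched_law \<in> (pos_seqs \<Otimes>\<^sub>M pos_seqs) \<rightarrow>\<^sub>M prob_algebra (\<Pi>\<^sub>M z\<in>{1..} \<times> {1..}. borel)"
proof (rule measurable_prob_algebra_generated[OF sets_PiM Int_stable_prod_algebra prod_algebra_sets_into_space])
  fix ab assume ab: "ab \<in> space (pos_seqs \<Otimes>\<^sub>M pos_seqs)"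
  show "prob_space (quenched_law ab)"
    using ab by (auto simp: quenched_law_def split: prod.splits
        intro!: prob_space_PiM prob_space_weight[simplified])
next
  show "sets (quenched_law ab) = sets (\<Pi>\<^sub>M z\<in>{1..} \<times> {1..}. borel)" for ab
    by (rule sets_quenched_law)
next
  fix A assume "A \<in> prod_algebra ({1..} \<times> {1..}) (\<lambda>_::nat \<times> nat. borel :: real measure)"
  then obtain J E where A: "A = prod_emb ({1..} \<times> {1..}) (\<lambda>_. borel) J (\<Pi>\<^sub>E j\<in>J. E j)"
    and J: "finite J" "J \<subseteq> {1..} \<times> {1..}" and E: "\<And>i. i \<in> J \<Longrightarrow> E i \<in> sets borel"
    by (elim prod_algebraE) auto
  have "emeasure (quenched_law ab) A = (\<Prod>z\<in>J. \<integral>\<^sup>+x\<in>E z.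
      ennreal (exponential_density (fst ab (fst z) + snd ab (snd z)) x) \<partial>lborel)"
    if "ab \<in> space (pos_seqs \<Otimes>\<^sub>M pos_seqs)" for ab
  proof -
    obtain a b where ab: "ab = (a, b)" by force
    let ?D = "\<lambda>(i, j). density lborel (\<lambda>x. ennreal (exponential_density (a i + b j) x))"
    have "A = prod_emb ({1..} \<times> {1..}) ?D J (\<Pi>\<^sub>E j\<in>J. E j)"
      unfolding A prod_emb_def by (auto simp: PiE_def split: prod.splits)
    then have "emeasure (quenched_law ab) A = (\<Prod>z\<in>J. emeasure (?D z) (E z))"
      unfolding quenched_law_def ab prod.case using that J E
      by (simp only:) (intro emeasure_PiM_emb; auto simp: ab intro!: prob_space_weight[simplified])
    also have "\<dots> = (\<Prod>z\<in>J. \<integral>\<^sup>+x\<in>E z.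
      ennreal (exponential_density (fst ab (fst z) + snd ab (snd z)) x) \<partial>lborel)"
      using E by (intro prod.cong refl) (auto simp: ab emeasure_density split: prod.splits)
    finally show ?thesis .
  qed
  moreover have "(\<lambda>ab. \<Prod>z\<in>J. \<integral>\<^sup>+x\<in>E z.
      ennreal (exponential_density (fst ab (fst z) + snd ab (snd z)) x) \<partial>lborel)
    \<in> borel_measurable (pos_seqs \<Otimes>\<^sub>M pos_seqs)"
  proof (intro borel_measurable_prod_ennreal)
    fix z assume z: "z \<in> J"
    have [measurable]: "E z \<in> sets borel" using E z by auto
    have [measurable]: "(\<lambda>ab. fst ab (fst z) + snd ab (snd z)) \<in> borel_measurable (pos_seqs \<Otimes>\<^sub>M pos_seqs)"
      using z J by (intro measurable_rate) auto
    show "(\<lambda>ab. \<integral>\<^sup>+x\<in>E z. ennreal (exponential_density (fst ab (fst z) + snd ab (snd z)) x) \<partial>lborel)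
      \<in> borel_measurable (pos_seqs \<Otimes>\<^sub>M pos_seqs)"
      unfolding exponential_density_def by measurable
  qed
  ultimately show "(\<lambda>ab. emeasure (quenched_law ab) A) \<in> borel_measurable (pos_seqs \<Otimes>\<^sub>M pos_seqs)"
    by (simp cong: measurable_cong)
qed

lemma (in exponential_model) emeasure_annealed_law:
  assumes "A \<in> sets (\<Pi>\<^sub>M z\<in>{1..} \<times> {1..}. borel)"
  shows "emeasure (annealed_law \<mu>) A = (\<integral>\<^sup>+ab. emeasure (quenched_law ab) A \<partial>\<mu>)"
  unfolding annealed_law_def
proof (rule emeasure_bind[OF not_empty _ assms])
  show "quenched_law \<in> \<mu> \<rightarrow>\<^sub>M subprob_algebra (\<Pi>\<^sub>M z\<in>{1..} \<times> {1..}. borel)"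
    using measurable_prob_algebraD[OF measurable_quenched_law] sets_joint_law
    by (simp cong: measurable_cong_sets)
qed

lemma directed_path_props:
  assumes "successively (\<lambda>(i, j) z. z = (i + 1, j) \<or> z = (i, j + 1)) \<pi>" "\<pi> \<noteq> []"
  shows "set \<pi> \<subseteq> {..fst (last \<pi>)} \<times> {..snd (last \<pi>)} \<and>
    length \<pi> \<le> fst (last \<pi>) + snd (last \<pi>) + (1 :: nat)"
  using assms(2,1)
proof (induction \<pi> rule: rev_nonempty_induct)
  case (single x)
  then show ?case by (cases x) auto
next
  case (snoc x xs)
  then have xs: "set xs \<subseteq> {..fst (last xs)} \<times> {..snd (last xs)}"
      "length xs \<le> fst (last xs) + snd (last xs) + 1"
    and x: "x = (fst (last xs) + 1, snd (last xs)) \<or> x = (fst (last xs), snd (last xs) + 1)"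
    by (auto simp: successively_append_iff split: prod.splits)
  from x have "fst (last xs) \<le> fst x" "snd (last xs) \<le> snd x"
      "fst x + snd x = fst (last xs) + snd (last xs) + 1"
    by auto
  with xs show ?case
    by (auto simp: subset_iff mem_Times_iff intro: order_trans)
qed

lemma finite_directed_paths: "finite (directed_paths p q)"
proof (rule finite_subset)
  show "directed_paths p q \<subseteq>
      {\<pi>. set \<pi> \<subseteq> {..fst q} \<times> {..snd q} \<and> length \<pi> \<le> fst q + snd q + 1}"
    using directed_path_props unfolding directed_paths_def by blast
  show "finite {\<pi>. set \<pi> \<subseteq> {..fst q} \<times> {..snd q} \<and> length \<pi> \<le> fst q + snd q + (1 :: nat)}"
    by (intro finite_lists_length_le) auto
qed

lemma directed_paths_nonempty:
  assumes "1 \<le> m" "1 \<le> n"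
  shows "directed_paths (1, 1) (m, n) \<noteq> {}"
proof -
  have extend: "\<pi> @ [z] \<in> directed_paths (1, 1) z"
    if "\<pi> \<in> directed_paths (1, 1) (i, j)" "z = (i + 1, j) \<or> z = (i, j + 1)" for \<pi> i j z
    using that by (auto simp: directed_paths_def successively_append_iff)
  have 1: "directed_paths (1, 1) (m, 1) \<noteq> {}"
    using assms(1)
  proof (induction m rule: dec_induct)
    case base
    have "[(1, 1)] \<in> directed_paths (1, 1) (1, 1)" by (simp add: directed_paths_def)
    then show ?case by blast
  next
    case (step i)
    then obtain \<pi> where "\<pi> \<in> directed_paths (1, 1) (i, 1)" by blast
    then show ?case using extend[of \<pi> i 1 "(Suc i, 1)"] by auto
  qed
  show ?thesis
    using assms(2)
  proof (induction n rule: dec_induct)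
    case base
    then show ?case using 1 .
  next
    case (step j)
    then obtain \<pi> where "\<pi> \<in> directed_paths (1, 1) (m, j)" by blast
    then show ?case using extend[of \<pi> m j "(m, Suc j)"] by auto
  qed
qed

lemma support_nonempty:
  assumes "prob_space \<nu>" "sets \<nu> = sets borel"
  shows "support \<nu> \<noteq> {}"
proof
  assume "support \<nu> = {}"
  then have "\<forall>x. \<exists>U. open U \<and> x \<in> U \<and> emeasure \<nu> U = 0"
    by (auto simp: support_def)
  then obtain U where U: "\<And>x. open (U x)" "\<And>x. x \<in> U x" "\<And>x. emeasure \<nu> (U x) = 0"
    by metis
  obtain F where F: "F \<subseteq> range U" "countable F" "\<Union>F = \<Union>(range U)"
    using Lindelof[of "range U"] U(1) by blast
  have "(\<Union>V\<in>F. V) \<in> null_sets \<nu>"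
    using F U by (intro null_sets_UN') (auto simp: null_sets_def assms(2))
  moreover have "(\<Union>V\<in>F. V) = space \<nu>"
    using F U(2) sets_eq_imp_space_eq[OF assms(2)] by auto
  ultimately show False
    using prob_space.emeasure_space_1[OF assms(1)] by (auto simp: null_sets_def)
qed

end

theory Submission
  imports Defs
begin

text \<open>
  Write \<open>G\<close> for the last-passage time. The two bounds on the shape function have different sources.

  Upper bound. Put independent boundary weights of rate \<open>a\<^sub>i\<close> at \<open>(i, 0)\<close> and of rate \<open>b\<^sub>j\<close> at
  \<open>(0, j)\<close>. The last-passage time of the enlarged quadrant dominates \<open>G\<close>, and by the Burke property its
  increments along each horizontal line are again independent exponentials of rates \<open>a\<^sub>i\<close>. Hence
  the quenched mean of \<open>G(m, n)\<close> is at most \<open>(\<Sum>i\<le>m. 1/a\<^sub>i) + (\<Sum>j\<le>n. 1/b\<^sub>j)\<close>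
  (\<open>nn_integral_last_passage_le\<close>); averaging over the rates and Fatou's lemma bound \<open>g\<close>. The Burke
  property is obtained from a single involution \<open>flip\<close> of three coordinates that preserves the
  product of exponential laws: applying it once at each site, row by row, turns the boundary weights
  at \<open>(i, 0)\<close> into the horizontal increments along the top row.

  Lower bound. Since both left endpoints are \<open>0\<close>, for each \<open>\<epsilon> > 0\<close> there is a row \<open>j\<close> with
  \<open>b\<^sub>j \<le> \<epsilon>\<close> and, by ergodicity, for large \<open>n\<close> a column \<open>i\<close> just left of \<open>n s\<close> with \<open>a\<^sub>i \<le> \<epsilon>\<close>. The
  path that follows the row to the column and then climbs the column collects weights of rates at
  most \<open>a\<^sub>k + \<epsilon>\<close> and then at most \<open>b\<^sub>l + \<epsilon>\<close>, and so has mean at least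
  \<open>(\<Sum>k. 1/(a\<^sub>k + \<epsilon>)) + (\<Sum>l. 1/(b\<^sub>l + \<epsilon>))\<close>. These terms are bounded by \<open>1/\<epsilon>\<close>, so that a Chernoff bound
  controls the path for fixed rates (\<open>quenched_lower_bound\<close>) and Birkhoff's theorem for bounded
  functions (\<open>birkhoff_bounded\<close>) evaluates the averages. Letting \<open>\<epsilon>\<close> tend to \<open>0\<close> finishes the proof,
  whether or not the expectations are finite.
\<close>

section \<open>Exponential laws\<close>

definition exp_law :: "real \<Rightarrow> real measure" where
  "exp_law r = density lborel (\<lambda>x. ennreal (exponential_density r x))"

lemma space_exp_law [simp]: "space (exp_law r) = UNIV"
  and sets_exp_law [simp, measurable_cong]: "sets (exp_law r) = sets borel"
  by (simp_all add: exp_law_def)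

lemma prob_space_exp_law: "0 < r \<Longrightarrow> prob_space (exp_law r)"
  unfolding exp_law_def by (rule prob_space_exponential_density)

lemma product_prob_space_exp_law: "(\<And>i. 0 < r i) \<Longrightarrow> product_prob_space (\<lambda>i. exp_law (r i))"
  by (simp add: product_prob_spaceI prob_space_exp_law)

lemma nn_integral_exp_law_id:
  assumes "0 < r"
  shows "(\<integral>\<^sup>+x. ennreal x \<partial>exp_law r) = ennreal (1 / r)"
proof -
  have "(\<integral>\<^sup>+x. ennreal (r * x) \<partial>exp_law r) = 1"
  proof -
    have "(\<integral>\<^sup>+x. ennreal (r * x) \<partial>exp_law r)
        = (\<integral>\<^sup>+x. ennreal (erlang_density 1 r x) \<partial>lborel)"
      unfolding exp_law_def using assms
      by (subst nn_integral_density)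
        (auto simp: exponential_density_def erlang_density_def ennreal_mult[symmetric] 
          power2_eq_square intro!: nn_integral_cong)
    also have "\<dots> = 1"
      using prob_space.emeasure_space_1[OF prob_space_erlang_density[OF assms, of 1]]
      by (simp add: emeasure_density cong: nn_integral_cong)
    finally show ?thesis .
  qed
  then have "ennreal r * (\<integral>\<^sup>+x. ennreal x \<partial>exp_law r) = 1"
    using assms by (subst nn_integral_cmult[symmetric]) (auto simp: ennreal_mult')
  then have "ennreal (1 / r) * (ennreal r * (\<integral>\<^sup>+x. ennreal x \<partial>exp_law r)) = ennreal (1 / r)"
    by simp
  then show ?thesis
    using assms by (simp add: mult.assoc[symmetric] ennreal_mult[symmetric])
qed

lemma AE_exp_law_nonneg: "AE x in exp_law r. 0 \<le> x"
  unfolding exp_law_def by (subst AE_density) (auto simp: exponential_density_def)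

lemma nn_integral_exp_law_laplace:
  assumes "0 < r" "0 \<le> l"
  shows "(\<integral>\<^sup>+x. ennreal (exp (- (l * x))) \<partial>exp_law r) = ennreal (r / (r + l))"
proof -
  have "(\<integral>\<^sup>+x. ennreal (exp (- (l * x))) \<partial>exp_law r)
      = (\<integral>\<^sup>+x. ennreal (r / (r + l)) * ennreal (exponential_density (r + l) x) \<partial>lborel)"
  proof -
    have "exponential_density r x * exp (- (l * x)) = r / (r + l) * exponential_density (r + l) x" for x
    proof -
      have "exp (- x * (r + l)) = exp (- x * r) * exp (- (l * x))"
        by (simp add: exp_add[symmetric] algebra_simps)
      then show ?thesis
        using assms by (simp add: exponential_density_def)
    qed
    then show ?thesis
      unfolding exp_law_def using assms
      by (subst nn_integral_density)
        (simp_all add: ennreal_mult[symmetric] exponential_density_nonneg)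
  qed
  also have "\<dots> = ennreal (r / (r + l))"
    using prob_space.emeasure_space_1[OF prob_space_exp_law[of "r + l"]] assms
    by (subst nn_integral_cmult) (auto simp: exp_law_def emeasure_density)
  finally show ?thesis .
qed

section \<open>The Burke property of one site\<close>

lemma nn_integral_lborel_shift:
  fixes f :: "real \<Rightarrow> ennreal"
  assumes [measurable]: "f \<in> borel_measurable borel"
  shows "(\<integral>\<^sup>+x. f (x + c) \<partial>lborel) = (\<integral>\<^sup>+x. f x \<partial>lborel)"
  using nn_integral_real_affine[OF assms, of 1 c] by (simp add: add.commute)

text \<open>
  On each of the regions \<open>h \<le> v\<close> and \<open>v < h\<close> the map is, up to a permutation of the coordinates, a
  translation of one coordinate by a function of the other two. It maps the first region to itself
  and likewise the second, so that Fubini's theorem and translation invariance suffice.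
\<close>

lemma lborel_burke:
  fixes K :: "real \<times> real \<times> real \<Rightarrow> ennreal"
  assumes [measurable]: "K \<in> borel_measurable (borel \<Otimes>\<^sub>M borel \<Otimes>\<^sub>M borel)"
  shows "(\<integral>\<^sup>+h. \<integral>\<^sup>+v. \<integral>\<^sup>+w. K (w + h - min h v, w + v - min h v, min h v) \<partial>lborel \<partial>lborel \<partial>lborel)
    = (\<integral>\<^sup>+h. \<integral>\<^sup>+v. \<integral>\<^sup>+w. K (h, v, w) \<partial>lborel \<partial>lborel \<partial>lborel)" (is "?L = ?R")
proof -
  have [measurable]: "K \<in> borel_measurable borel"
    using assms by (simp add: borel_prod)
  define A where "A = (\<lambda>(h, v, w). indicator {(x, y). x \<le> y} (h, v) * K (w, w + v - h, h))"
  define B where "B = (\<lambda>(h, v, w). indicator {(x, y). y < x} (h, v) * K (w + h - v, w, v))"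
  define A' where "A' = (\<lambda>(h, v, w). indicator {(x, y). x \<le> y} (h, v) * K (h, v, w))"
  define B' where "B' = (\<lambda>(h, v, w). indicator {(x, y). y < x} (h, v) * K (h, v, w))"
  have [measurable]: "{(x::real, y). x \<le> y} \<in> sets (borel \<Otimes>\<^sub>M borel)" "{(x::real, y). y < x} \<in> sets (borel \<Otimes>\<^sub>M borel)"
    unfolding borel_prod split_beta'
    by (rule borel_closed borel_open, intro open_Collect_less closed_Collect_le continuous_intros)+
  have m [measurable]: "A \<in> borel_measurable (borel \<Otimes>\<^sub>M borel \<Otimes>\<^sub>M borel)"
     "B \<in> borel_measurable (borel \<Otimes>\<^sub>M borel \<Otimes>\<^sub>M borel)"
     "A' \<in> borel_measurable (borel \<Otimes>\<^sub>M borel \<Otimes>\<^sub>M borel)"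
     "B' \<in> borel_measurable (borel \<Otimes>\<^sub>M borel \<Otimes>\<^sub>M borel)"
    unfolding A_def B_def A'_def B'_def by measurable
  have add: "(\<integral>\<^sup>+h. \<integral>\<^sup>+v. \<integral>\<^sup>+w. f (h, v, w) + g (h, v, w) \<partial>lborel \<partial>lborel \<partial>lborel)
      = (\<integral>\<^sup>+h. \<integral>\<^sup>+v. \<integral>\<^sup>+w. f (h, v, w) \<partial>lborel \<partial>lborel \<partial>lborel)
       + (\<integral>\<^sup>+h. \<integral>\<^sup>+v. \<integral>\<^sup>+w. g (h, v, w) \<partial>lborel \<partial>lborel \<partial>lborel)"
    if [measurable]: "f \<in> borel_measurable (borel \<Otimes>\<^sub>M borel \<Otimes>\<^sub>M borel)"
      "g \<in> borel_measurable (borel \<Otimes>\<^sub>M borel \<Otimes>\<^sub>M borel)" for f g :: "real \<times> real \<times> real \<Rightarrow> ennreal"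
    by (simp add: nn_integral_add)
  have "?L = (\<integral>\<^sup>+h. \<integral>\<^sup>+v. \<integral>\<^sup>+w. A (h, v, w) + B (h, v, w) \<partial>lborel \<partial>lborel \<partial>lborel)"
    by (intro nn_integral_cong) (auto simp: A_def B_def min_def)
  also have "\<dots> = (\<integral>\<^sup>+h. \<integral>\<^sup>+v. \<integral>\<^sup>+w. A (h, v, w) \<partial>lborel \<partial>lborel \<partial>lborel)
       + (\<integral>\<^sup>+h. \<integral>\<^sup>+v. \<integral>\<^sup>+w. B (h, v, w) \<partial>lborel \<partial>lborel \<partial>lborel)"
    using add[OF m(1,2)] by simp
  also have "(\<integral>\<^sup>+h. \<integral>\<^sup>+v. \<integral>\<^sup>+w. A (h, v, w) \<partial>lborel \<partial>lborel \<partial>lborel)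
      = (\<integral>\<^sup>+h. \<integral>\<^sup>+w. \<integral>\<^sup>+v. A (h, v, w) \<partial>lborel \<partial>lborel \<partial>lborel)"
    by (intro nn_integral_cong lborel_pair.Fubini') simp
  also have "\<dots> = (\<integral>\<^sup>+h. \<integral>\<^sup>+w. \<integral>\<^sup>+v. A' (w, v, h) \<partial>lborel \<partial>lborel \<partial>lborel)"
  proof (rule nn_integral_cong, rule nn_integral_cong)
    fix h w :: real
    have "(\<integral>\<^sup>+v. A (h, v, w) \<partial>lborel) = (\<integral>\<^sup>+v. A' (w, (v + (w - h)), h) \<partial>lborel)"
      by (intro nn_integral_cong) (auto simp: A_def A'_def indicator_def algebra_simps)
    also have "\<dots> = (\<integral>\<^sup>+v. A' (w, v, h) \<partial>lborel)"
      by (intro nn_integral_lborel_shift) simp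
    finally show "(\<integral>\<^sup>+v. A (h, v, w) \<partial>lborel) = (\<integral>\<^sup>+v. A' (w, v, h) \<partial>lborel)" .
  qed
  also have "\<dots> = (\<integral>\<^sup>+w. \<integral>\<^sup>+h. \<integral>\<^sup>+v. A' (w, v, h) \<partial>lborel \<partial>lborel \<partial>lborel)"
    by (intro lborel_pair.Fubini') simp
  also have "\<dots> = (\<integral>\<^sup>+w. \<integral>\<^sup>+v. \<integral>\<^sup>+h. A' (w, v, h) \<partial>lborel \<partial>lborel \<partial>lborel)"
    by (intro nn_integral_cong lborel_pair.Fubini') simp
  also have "(\<integral>\<^sup>+h. \<integral>\<^sup>+v. \<integral>\<^sup>+w. B (h, v, w) \<partial>lborel \<partial>lborel \<partial>lborel)
      = (\<integral>\<^sup>+v. \<integral>\<^sup>+h. \<integral>\<^sup>+w. B (h, v, w) \<partial>lborel \<partial>lborel \<partial>lborel)"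
    by (intro lborel_pair.Fubini') simp
  also have "\<dots> = (\<integral>\<^sup>+v. \<integral>\<^sup>+w. \<integral>\<^sup>+h. B (h, v, w) \<partial>lborel \<partial>lborel \<partial>lborel)"
    by (intro nn_integral_cong lborel_pair.Fubini') simp
  also have "\<dots> = (\<integral>\<^sup>+v. \<integral>\<^sup>+w. \<integral>\<^sup>+h. B' (h, w, v) \<partial>lborel \<partial>lborel \<partial>lborel)"
  proof (rule nn_integral_cong, rule nn_integral_cong)
    fix v w :: real
    have "(\<integral>\<^sup>+h. B (h, v, w) \<partial>lborel) = (\<integral>\<^sup>+h. B' ((h + (w - v)), w, v) \<partial>lborel)"
      by (intro nn_integral_cong) (auto simp: B_def B'_def indicator_def algebra_simps)
    also have "\<dots> = (\<integral>\<^sup>+h. B' (h, w, v) \<partial>lborel)"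
      by (intro nn_integral_lborel_shift) simp
    finally show "(\<integral>\<^sup>+h. B (h, v, w) \<partial>lborel) = (\<integral>\<^sup>+h. B' (h, w, v) \<partial>lborel)" .
  qed
  also have "\<dots> = (\<integral>\<^sup>+v. \<integral>\<^sup>+h. \<integral>\<^sup>+w. B' (h, w, v) \<partial>lborel \<partial>lborel \<partial>lborel)"
    by (intro nn_integral_cong lborel_pair.Fubini') simp
  also have "\<dots> = (\<integral>\<^sup>+h. \<integral>\<^sup>+v. \<integral>\<^sup>+w. B' (h, w, v) \<partial>lborel \<partial>lborel \<partial>lborel)"
    by (intro lborel_pair.Fubini') simp
  also have "\<dots> = (\<integral>\<^sup>+h. \<integral>\<^sup>+w. \<integral>\<^sup>+v. B' (h, w, v) \<partial>lborel \<partial>lborel \<partial>lborel)"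
    by (intro nn_integral_cong lborel_pair.Fubini') simp
  also have "(\<integral>\<^sup>+w. \<integral>\<^sup>+v. \<integral>\<^sup>+h. A' (w, v, h) \<partial>lborel \<partial>lborel \<partial>lborel) + \<dots>
      = (\<integral>\<^sup>+h. \<integral>\<^sup>+v. \<integral>\<^sup>+w. A' (h, v, w) + B' (h, v, w) \<partial>lborel \<partial>lborel \<partial>lborel)"
    using add[OF m(3,4)] by simp
  also have "\<dots> = ?R"
    by (intro nn_integral_cong) (auto simp: A'_def B'_def indicator_def)
  finally show ?thesis .
qed

text \<open>
  The local Burke property. In the corner growth picture \<open>h\<close> and \<open>v\<close> are the increments of the passage
  time along the lower and the left edge of a unit square and \<open>w\<close> is the weight at its upper right
  corner; the first two components are then the increments along the upper and the right edge. The third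
  component makes the map an involution. It preserves the joint density because that is a function of
  \<open>a h + b v + (a + b) w\<close> on the positive octant, and the map preserves both.
\<close>

lemma exp_law_burke:
  fixes F :: "real \<times> real \<times> real \<Rightarrow> ennreal"
  assumes "0 < a" "0 < b"
    and [measurable]: "F \<in> borel_measurable (borel \<Otimes>\<^sub>M borel \<Otimes>\<^sub>M borel)"
  shows "(\<integral>\<^sup>+h. \<integral>\<^sup>+v. \<integral>\<^sup>+w. F (w + h - min h v, w + v - min h v, min h v)
      \<partial>exp_law (a + b) \<partial>exp_law b \<partial>exp_law a)
    = (\<integral>\<^sup>+h. \<integral>\<^sup>+v. \<integral>\<^sup>+w. F (h, v, w) \<partial>exp_law (a + b) \<partial>exp_law b \<partial>exp_law a)"
proof -
  define D where "D = (\<lambda>(h, v, w). ennreal (exponential_density a h) *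
    (ennreal (exponential_density b v) * ennreal (exponential_density (a + b) w)))"
  have [measurable]: "D \<in> borel_measurable (borel \<Otimes>\<^sub>M borel \<Otimes>\<^sub>M borel)"
    unfolding D_def by measurable
  have to_lborel: "(\<integral>\<^sup>+h. \<integral>\<^sup>+v. \<integral>\<^sup>+w. H (h, v, w) \<partial>exp_law (a + b) \<partial>exp_law b \<partial>exp_law a)
      = (\<integral>\<^sup>+h. \<integral>\<^sup>+v. \<integral>\<^sup>+w. D (h, v, w) * H (h, v, w) \<partial>lborel \<partial>lborel \<partial>lborel)"
    if [measurable]: "H \<in> borel_measurable (borel \<Otimes>\<^sub>M borel \<Otimes>\<^sub>M borel)" for H
    by (simp add: exp_law_def nn_integral_density nn_integral_cmult[symmetric] D_def mult.assoc)
  have D_flip: "D (w + h - min h v, w + v - min h v, min h v) = D (h, v, w)" for h v w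
  proof (cases "0 \<le> h \<and> 0 \<le> v \<and> 0 \<le> w")
    case True
    let ?h = "w + h - min h v" and ?v = "w + v - min h v" and ?w = "min h v"
    have "exponential_density a ?h * (exponential_density b ?v * exponential_density (a + b) ?w)
      = exponential_density a h * (exponential_density b v * exponential_density (a + b) w)"
    proof -
      have "- ?h * a + (- ?v * b + - ?w * (a + b)) = - h * a + (- v * b + - w * (a + b))"
        by (simp add: algebra_simps)
      then have "exp (- ?h * a) * (exp (- ?v * b) * exp (- ?w * (a + b)))
          = exp (- h * a) * (exp (- v * b) * exp (- w * (a + b)))"
        by (simp only: exp_add[symmetric])
      moreover have "\<not> ?h < 0" "\<not> ?v < 0" "\<not> ?w < 0" "\<not> h < 0" "\<not> v < 0" "\<not> w < 0"
        using True by (auto simp: min_def)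
      ultimately show ?thesis
        by (simp add: exponential_density_def del: minus_diff_eq)
    qed
    then show ?thesis
      using assms by (simp add: D_def ennreal_mult[symmetric] exponential_density_nonneg)
  next
    case False
    then show ?thesis
      by (auto simp: D_def exponential_density_def min_def)
  qed
  have "(\<integral>\<^sup>+h. \<integral>\<^sup>+v. \<integral>\<^sup>+w. F (w + h - min h v, w + v - min h v, min h v)
      \<partial>exp_law (a + b) \<partial>exp_law b \<partial>exp_law a)
    = (\<integral>\<^sup>+h. \<integral>\<^sup>+v. \<integral>\<^sup>+w. (\<lambda>x. D x * F x) (w + h - min h v, w + v - min h v, min h v)
         \<partial>lborel \<partial>lborel \<partial>lborel)"
    using to_lborel[of "\<lambda>(h, v, w). F (w + h - min h v, w + v - min h v, min h v)"]
    by (simp add: D_flip)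
  also have "\<dots> = (\<integral>\<^sup>+h. \<integral>\<^sup>+v. \<integral>\<^sup>+w. D (h, v, w) * F (h, v, w) \<partial>lborel \<partial>lborel \<partial>lborel)"
    by (rule lborel_burke) measurable
  also have "\<dots> = (\<integral>\<^sup>+h. \<integral>\<^sup>+v. \<integral>\<^sup>+w. F (h, v, w) \<partial>exp_law (a + b) \<partial>exp_law b \<partial>exp_law a)"
    by (rule to_lborel[symmetric]) measurable
  finally show ?thesis .
qed

text \<open>
  The map of the local Burke property acting on three coordinates of a configuration.
\<close>

definition flip :: "'i \<Rightarrow> 'i \<Rightarrow> 'i \<Rightarrow> ('i \<Rightarrow> real) \<Rightarrow> 'i \<Rightarrow> real" where
  "flip p q z x = x(p := x z + x p - min (x p) (x q), q := x z + x q - min (x p) (x q),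
     z := min (x p) (x q))"

lemma measurable_flip:
  fixes I :: "'i set"
  assumes "p \<in> I" "q \<in> I" "z \<in> I"
  shows "flip p q z \<in> (\<Pi>\<^sub>M i\<in>I. exp_law (r i)) \<rightarrow>\<^sub>M (\<Pi>\<^sub>M i\<in>I. exp_law (r i))"
proof (rule measurable_PiM_single')
  have [measurable]: "(\<lambda>x. x i) \<in> borel_measurable (\<Pi>\<^sub>M i\<in>I. exp_law (r i))" if "i \<in> I" for i
    using that by measurable
  note [measurable] = this[OF assms(1)] this[OF assms(2)] this[OF assms(3)]
  show "(\<lambda>x. flip p q z x i) \<in> (\<Pi>\<^sub>M i\<in>I. exp_law (r i)) \<rightarrow>\<^sub>M exp_law (r i)" if "i \<in> I" for i
    using that unfolding flip_def fun_upd_apply by (cases "i = z"; cases "i = q"; cases "i = p") simp_all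
  show "flip p q z \<in> space (\<Pi>\<^sub>M i\<in>I. exp_law (r i)) \<rightarrow> (\<Pi>\<^sub>E i\<in>I. space (exp_law (r i)))"
    using assms by (auto simp: flip_def space_PiM PiE_def extensional_def)
qed

lemma nn_integral_flip:
  fixes I :: "'i set" and r :: "'i \<Rightarrow> real"
  assumes I: "finite I" "p \<in> I" "q \<in> I" "z \<in> I" "p \<noteq> q" "p \<noteq> z" "q \<noteq> z"
    and r: "\<And>i. 0 < r i" "r z = r p + r q"
    and f: "f \<in> borel_measurable (\<Pi>\<^sub>M i\<in>I. exp_law (r i))"
  shows "(\<integral>\<^sup>+x. f (flip p q z x) \<partial>(\<Pi>\<^sub>M i\<in>I. exp_law (r i))) = (\<integral>\<^sup>+x. f x \<partial>(\<Pi>\<^sub>M i\<in>I. exp_law (r i)))"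
proof -
  interpret product_prob_space "\<lambda>i. exp_law (r i)" by (rule product_prob_space_exp_law[OF r(1)])
  define J where "J = I - {p, q, z}"
  have J: "finite J" "p \<notin> J" "q \<notin> insert p J" "z \<notin> insert q (insert p J)"
    and IJ: "I = insert z (insert q (insert p J))"
    using I by (auto simp: J_def)
  have iter: "(\<integral>\<^sup>+x. H x \<partial>(\<Pi>\<^sub>M i\<in>I. exp_law (r i)))
      = (\<integral>\<^sup>+x. \<integral>\<^sup>+h. \<integral>\<^sup>+v. \<integral>\<^sup>+w. H (x(p := h, q := v, z := w)) 
          \<partial>exp_law (r z) \<partial>exp_law (r q) \<partial>exp_law (r p) \<partial>(\<Pi>\<^sub>M i\<in>J. exp_law (r i)))"
    if H: "H \<in> borel_measurable (\<Pi>\<^sub>M i\<in>I. exp_law (r i))" for H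
  proof -
    have 1: "H \<in> borel_measurable (\<Pi>\<^sub>M i\<in>insert z (insert q (insert p J)). exp_law (r i))"
      using H IJ by simp
    have 2: "(\<lambda>x. \<integral>\<^sup>+w. H (x(z := w)) \<partial>exp_law (r z)) \<in> borel_measurable (\<Pi>\<^sub>M i\<in>insert q (insert p J). exp_law (r i))"
      using 1 by measurable
    have 3: "(\<lambda>x. \<integral>\<^sup>+v. \<integral>\<^sup>+w. H (x(q := v, z := w)) \<partial>exp_law (r z) \<partial>exp_law (r q))
        \<in> borel_measurable (\<Pi>\<^sub>M i\<in>insert p J. exp_law (r i))"
      using 2 by measurable
    show ?thesis
      unfolding IJ using J
      by (subst product_nn_integral_insert[OF _ _ 1], simp, simp,
          subst product_nn_integral_insert[OF _ _ 2], simp, simp,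
          subst product_nn_integral_insert[OF _ _ 3]) simp_all
  qed
  have "(\<integral>\<^sup>+x. f (flip p q z x) \<partial>(\<Pi>\<^sub>M i\<in>I. exp_law (r i)))
      = (\<integral>\<^sup>+x. \<integral>\<^sup>+h. \<integral>\<^sup>+v. \<integral>\<^sup>+w. f (flip p q z (x(p := h, q := v, z := w)))
          \<partial>exp_law (r z) \<partial>exp_law (r q) \<partial>exp_law (r p) \<partial>(\<Pi>\<^sub>M i\<in>J. exp_law (r i)))"
    by (rule iter[OF measurable_compose[OF measurable_flip f]]) fact+
  also have "\<dots> = (\<integral>\<^sup>+x. \<integral>\<^sup>+h. \<integral>\<^sup>+v. \<integral>\<^sup>+w. f (x(p := h, q := v, z := w))
          \<partial>exp_law (r z) \<partial>exp_law (r q) \<partial>exp_law (r p) \<partial>(\<Pi>\<^sub>M i\<in>J. exp_law (r i)))"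
  proof (rule nn_integral_cong)
    fix x assume x: "x \<in> space (\<Pi>\<^sub>M i\<in>J. exp_law (r i))"
    define F where "F = (\<lambda>(h, v, w). f (x(p := h, q := v, z := w)))"
    have "(\<lambda>(h, v, w). x(p := h, q := v, z := w)) \<in> borel \<Otimes>\<^sub>M borel \<Otimes>\<^sub>M borel \<rightarrow>\<^sub>M (\<Pi>\<^sub>M i\<in>I. exp_law (r i))"
    proof (rule measurable_PiM_single')
      show "(\<lambda>y. (case y of (h, v, w) \<Rightarrow> x(p := h, q := v, z := w)) i) \<in> borel \<Otimes>\<^sub>M borel \<Otimes>\<^sub>M borel \<rightarrow>\<^sub>M exp_law (r i)" for i
        by (cases "i = z"; cases "i = q"; cases "i = p") (simp_all add: split_beta')
      show "(\<lambda>(h, v, w). x(p := h, q := v, z := w)) \<in> space (borel \<Otimes>\<^sub>M borel \<Otimes>\<^sub>M borel) \<rightarrow> (\<Pi>\<^sub>E i\<in>I. space (exp_law (r i)))"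
        using x I by (auto simp: space_PiM PiE_def extensional_def J_def)
    qed
    then have "F \<in> borel_measurable (borel \<Otimes>\<^sub>M borel \<Otimes>\<^sub>M borel)"
      using measurable_compose[OF _ f] unfolding F_def by (simp add: split_beta')
    from exp_law_burke[OF r(1)[of p] r(1)[of q] this]
    show "(\<integral>\<^sup>+h. \<integral>\<^sup>+v. \<integral>\<^sup>+w. f (flip p q z (x(p := h, q := v, z := w)))
          \<partial>exp_law (r z) \<partial>exp_law (r q) \<partial>exp_law (r p))
      = (\<integral>\<^sup>+h. \<integral>\<^sup>+v. \<integral>\<^sup>+w. f (x(p := h, q := v, z := w))
          \<partial>exp_law (r z) \<partial>exp_law (r q) \<partial>exp_law (r p))"
      using I by (simp add: F_def flip_def r(2) fun_upd_twist)
  qed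
  also have "\<dots> = (\<integral>\<^sup>+x. f x \<partial>(\<Pi>\<^sub>M i\<in>I. exp_law (r i)))"
    by (rule iter[OF f, symmetric])
  finally show ?thesis .
qed

section \<open>Last-passage times\<close>

lemma directed_paths_snoc:
  assumes "\<pi> \<in> directed_paths p (i, j)" "z = (i + 1, j) \<or> z = (i, j + 1)"
  shows "\<pi> @ [z] \<in> directed_paths p z"
  using assms by (auto simp: directed_paths_def successively_append_iff)

lemma last_passage_ge_path:
  assumes "\<pi> \<in> directed_paths (1, 1) (m, n)"
  shows "(\<Sum>z\<leftarrow>\<pi>. W z) \<le> last_passage W m n"
  unfolding last_passage_def using assms by (intro Max_ge finite_imageI finite_directed_paths imageI)

lemma last_passage_attained:
  assumes "1 \<le> m" "1 \<le> n"
  obtains \<pi> where "\<pi> \<in> directed_paths (1, 1) (m, n)" "last_passage W m n = (\<Sum>z\<leftarrow>\<pi>. W z)"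
proof -
  have "last_passage W m n \<in> (\<lambda>\<pi>. \<Sum>z\<leftarrow>\<pi>. W z) ` directed_paths (1, 1) (m, n)"
    unfolding last_passage_def using directed_paths_nonempty[OF assms]
    by (intro Max_in finite_imageI finite_directed_paths) auto
  then show ?thesis using that by blast
qed

lemma last_passage_step:
  assumes "1 \<le> i" "1 \<le> j"
  shows "last_passage W i j + W (i + 1, j) \<le> last_passage W (i + 1) j"
    and "last_passage W i j + W (i, j + 1) \<le> last_passage W i (j + 1)"
proof -
  obtain \<pi> where \<pi>: "\<pi> \<in> directed_paths (1, 1) (i, j)" "last_passage W i j = (\<Sum>z\<leftarrow>\<pi>. W z)"
    using last_passage_attained[OF assms] .
  show "last_passage W i j + W (i + 1, j) \<le> last_passage W (i + 1) j"
    using last_passage_ge_path[OF directed_paths_snoc[OF \<pi>(1), of "(i + 1, j)"], of W] \<pi>(2) by simp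
  show "last_passage W i j + W (i, j + 1) \<le> last_passage W i (j + 1)"
    using last_passage_ge_path[OF directed_paths_snoc[OF \<pi>(1), of "(i, j + 1)"], of W] \<pi>(2) by simp
qed

text \<open>
  The bound by the path that runs along row \<open>j\<close> to column \<open>i\<close> and then up that column. The weights
  omitted before and after it are nonnegative.
\<close>

lemma last_passage_ge_corner_path:
  assumes W: "\<And>z. z \<in> {1..} \<times> {1..} \<Longrightarrow> 0 \<le> W z"
    and ij: "1 \<le> i" "i \<le> m" "1 \<le> j" "j \<le> n"
  shows "(\<Sum>k=1..i. W (k, j)) + (\<Sum>l=j+1..n. W (i, l)) \<le> last_passage W m n"
proof -
  have "last_passage W 1 1 \<ge> W (1, 1)"
    using last_passage_ge_path[of "[(1, 1)]" 1 1 W] by (simp add: directed_paths_def)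
  have col: "W (1, l) \<le> last_passage W 1 l" if "1 \<le> l" for l
    using that
  proof (induction l rule: dec_induct)
    case (step l)
    then show ?case using last_passage_step(2)[of 1 l W] W[of "(1, l)"] by simp
  qed fact
  have row: "(\<Sum>k=1..k'. W (k, j)) \<le> last_passage W k' j" if "1 \<le> k'" for k'
    using that
  proof (induction k' rule: dec_induct)
    case (step k)
    then show ?case using last_passage_step(1)[of k j W] ij by simp
  qed (use ij col in simp)
  have "(\<Sum>k=1..i. W (k, j)) + (\<Sum>l=j+1..l'. W (i, l)) \<le> last_passage W i l'" if "j \<le> l'" for l'
    using that
  proof (induction l' rule: dec_induct)
    case base
    then show ?case using row[OF ij(1)] by simp
  next
    case (step l)
    then show ?case using last_passage_step(2)[of i l W] ij by simp
  qed
  also have "last_passage W i n \<le> last_passage W m n"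
    using ij(2)
  proof (induction m rule: dec_induct)
    case (step k)
    then show ?case using last_passage_step(1)[of k n W] W[of "(Suc k, n)"] ij by simp
  qed simp
  finally show ?thesis using ij by simp
qed

text \<open>
  A supersolution of the recursion for last-passage times dominates them.
\<close>

lemma last_passage_le:
  assumes "1 \<le> m" "1 \<le> n"
    and start: "W (1, 1) \<le> H 1 1"
    and step: "\<And>i j. 1 \<le> i \<Longrightarrow> i < m \<Longrightarrow> 1 \<le> j \<Longrightarrow> j \<le> n \<Longrightarrow> H i j + W (i + 1, j) \<le> H (i + 1) j"
      "\<And>i j. 1 \<le> i \<Longrightarrow> i \<le> m \<Longrightarrow> 1 \<le> j \<Longrightarrow> j < n \<Longrightarrow> H i j + W (i, j + 1) \<le> H i (j + 1)"
  shows "last_passage W m n \<le> H m n"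
proof -
  have path: "1 \<le> fst (last \<pi>) \<and> 1 \<le> snd (last \<pi>) \<and>
      (fst (last \<pi>) \<le> m \<longrightarrow> snd (last \<pi>) \<le> n \<longrightarrow> (\<Sum>z\<leftarrow>\<pi>. W z) \<le> H (fst (last \<pi>)) (snd (last \<pi>)))"
    if "\<pi> \<noteq> []" "hd \<pi> = (1, 1)" "successively (\<lambda>(i, j) z. z = (i + 1, j) \<or> z = (i, j + 1)) \<pi>" for \<pi>
    using that
  proof (induction \<pi> rule: rev_nonempty_induct)
    case (single x)
    then show ?case using start by simp
  next
    case (snoc x \<pi>)
    obtain i j where ij: "last \<pi> = (i, j)" by force
    have IH: "1 \<le> i" "1 \<le> j" "i \<le> m \<Longrightarrow> j \<le> n \<Longrightarrow> (\<Sum>z\<leftarrow>\<pi>. W z) \<le> H i j"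
      and x: "x = (i + 1, j) \<or> x = (i, j + 1)"
      using snoc ij by (auto simp: successively_append_iff)
    from x show ?case
    proof
      assume "x = (i + 1, j)"
      then show ?thesis using IH step(1)[of i j] by auto
    next
      assume "x = (i, j + 1)"
      then show ?thesis using IH step(2)[of i j] by auto
    qed
  qed
  obtain \<pi> where \<pi>: "\<pi> \<in> directed_paths (1, 1) (m, n)" "last_passage W m n = (\<Sum>z\<leftarrow>\<pi>. W z)"
    using last_passage_attained[OF assms(1,2)] .
  then show ?thesis using path[of \<pi>] by (simp add: directed_paths_def)
qed

lemma directed_paths_subset_box:
  assumes "\<pi> \<in> directed_paths (1, 1) (m, n)"
  shows "set \<pi> \<subseteq> {1..m} \<times> {1..n}"
proof -
  have "set \<pi> \<subseteq> {1..} \<times> {1..}"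
    if "\<pi> \<noteq> []" "hd \<pi> = (1, 1)" "successively (\<lambda>(i, j) z. z = (i + 1, j) \<or> z = (i, j + 1)) \<pi>"
    using that
  proof (induction \<pi> rule: rev_nonempty_induct)
    case (snoc x \<pi>)
    then have \<pi>: "set \<pi> \<subseteq> {1..} \<times> {1..}" and x: "case last \<pi> of (i, j) \<Rightarrow> x = (i + 1, j) \<or> x = (i, j + 1)"
      by (auto simp: successively_append_iff)
    from \<pi> snoc(1) have "last \<pi> \<in> {1..} \<times> {1..}" by auto
    with \<pi> x show ?case by auto
  qed auto
  then show ?thesis
    using assms directed_path_props[of \<pi>] by (force simp: directed_paths_def)
qed

lemma last_passage_cong:
  assumes "\<And>z. z \<in> {1..m} \<times> {1..n} \<Longrightarrow> W z = W' z"
  shows "last_passage W m n = last_passage W' m n"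
  unfolding last_passage_def
  using assms directed_paths_subset_box
  by (intro arg_cong[where f = Max] image_cong refl arg_cong[where f = sum_list] map_cong) blast

lemma measurable_last_passage:
  assumes "{1..m} \<times> {1..n} \<subseteq> I" "1 \<le> m" "1 \<le> n"
  shows "(\<lambda>W. last_passage W m n) \<in> borel_measurable (\<Pi>\<^sub>M z\<in>I. exp_law (r z))"
proof -
  have "(\<lambda>W. Max ((\<lambda>\<pi>. (\<Sum>z\<leftarrow>\<pi>. W z)) ` directed_paths (1, 1) (m, n)))
      \<in> borel_measurable (\<Pi>\<^sub>M z\<in>I. exp_law (r z))"
  proof (rule borel_measurable_Max[OF finite_directed_paths])
    fix \<pi> assume "\<pi> \<in> directed_paths (1, 1) (m, n)"
    then have "set \<pi> \<subseteq> I"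
      using directed_paths_subset_box assms(1) by blast
    then show "(\<lambda>W. \<Sum>z\<leftarrow>\<pi>. W z) \<in> borel_measurable (\<Pi>\<^sub>M z\<in>I. exp_law (r z))"
    proof (induction \<pi>)
      case (Cons z \<pi>)
      have "(\<lambda>W. W z) \<in> borel_measurable (\<Pi>\<^sub>M z\<in>I. exp_law (r z))"
        using measurable_component_singleton[of z I "\<lambda>z. exp_law (r z)"] Cons
        by (simp cong: measurable_cong_sets)
      with Cons show ?case by simp
    qed simp
  qed
  then show ?thesis by (simp add: last_passage_def)
qed

section \<open>Sweeping the quadrant\<close>

text \<open>
  The coordinate \<open>(i, 0)\<close> stores the horizontal increment from column \<open>i - 1\<close> to column \<open>i\<close> on the line
  reached so far. While row \<open>j\<close> is swept from left to right, \<open>(0, j)\<close> stores the vertical increment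
  from line \<open>j - 1\<close> to line \<open>j\<close> in the current column.
\<close>

fun flip_row :: "nat \<Rightarrow> nat \<Rightarrow> (nat \<times> nat \<Rightarrow> real) \<Rightarrow> nat \<times> nat \<Rightarrow> real" where
  "flip_row j 0 x = x"
| "flip_row j (Suc i) x = flip (Suc i, 0) (0, j) (Suc i, j) (flip_row j i x)"

fun flip_rows :: "nat \<Rightarrow> nat \<Rightarrow> (nat \<times> nat \<Rightarrow> real) \<Rightarrow> nat \<times> nat \<Rightarrow> real" where
  "flip_rows m 0 x = x"
| "flip_rows m (Suc j) x = flip_row (Suc j) m (flip_rows m j x)"

lemma flip_row_other:
  assumes "z \<noteq> (0, j)" "z \<notin> {1..i} \<times> {0, j}"
  shows "flip_row j i x z = x z"
  using assms by (cases z, induction i) (auto simp: flip_def)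

lemma flip_rows_other:
  assumes "j < snd z"
  shows "flip_rows m j x z = x z"
  using assms
proof (induction j)
  case (Suc j)
  then have "flip_row (Suc j) m (flip_rows m j x) z = flip_rows m j x z"
    by (intro flip_row_other) auto
  with Suc show ?case by simp
qed simp

lemma flip_row_boundary:
  assumes "1 \<le> j" "k \<le> i"
  shows "1 \<le> k \<Longrightarrow> flip_row j i x (k, 0) = flip_row j k x (k, 0)"
  using assms(2)
proof (induction i rule: dec_induct)
  case (step i)
  then show ?case using assms(1) by (auto simp: flip_def)
qed simp

text \<open>
  Both routes around the rectangle between lines \<open>j - 1\<close> and \<open>j\<close> give the same increment of the
  passage time, because each flip changes both stored increments by the same amount.
\<close>

lemma flip_row_conserve:
  assumes "1 \<le> j"
  shows "flip_row j i x (0, j) - x (0, j) = (\<Sum>k=1..i. flip_row j i x (k, 0) - x (k, 0))"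
proof (induction i)
  case (Suc i)
  have "flip_row j i x (Suc i, 0) = x (Suc i, 0)"
    using assms by (intro flip_row_other) auto
  moreover have "flip_row j (Suc i) x (k, 0) = flip_row j i x (k, 0)" if "k \<in> {1..i}" for k
    using that assms by (auto simp: flip_def)
  ultimately show ?case
    using Suc assms by (simp add: flip_def cong: sum.cong_simp)
qed simp

lemma flip_row_ge:
  assumes "1 \<le> j" "1 \<le> i"
  shows "x (i, j) \<le> flip_row j i x (i, 0)" "x (i, j) \<le> flip_row j i x (0, j)"
proof -
  obtain i' where i: "i = Suc i'" using assms by (cases i) auto
  have "flip_row j i' x (i, j) = x (i, j)"
    using assms i by (intro flip_row_other) auto
  then show "x (i, j) \<le> flip_row j i x (i, 0)" "x (i, j) \<le> flip_row j i x (0, j)"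
    using assms i by (auto simp: flip_def min_def)
qed

text \<open>
  The right-hand side is the last-passage time with boundary: up the left edge, then along the line
  of height \<open>n\<close>.
\<close>

lemma last_passage_le_flip_rows:
  assumes mn: "1 \<le> m" "1 \<le> n" and x: "0 \<le> x (0, 1)"
  shows "last_passage x m n \<le> (\<Sum>j=1..n. x (0, j)) + (\<Sum>i=1..m. flip_rows m n x (i, 0))"
proof -
  \<comment> \<open>The passage time with boundary; it increases by at least the weight in each step.\<close>
  define H where "H = (\<lambda>i j. (\<Sum>l=1..j. x (0, l)) + (\<Sum>k=1..i. flip_rows m j x (k, 0)))"
  have right: "H i j + x (i + 1, j) \<le> H (i + 1) j" if i: "i < m" and j: "1 \<le> j" for i j
  proof -
    obtain j' where j': "j = Suc j'" using j by (cases j) auto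
    have "x (i + 1, j) = flip_rows m j' x (i + 1, j)"
      using j' by (intro flip_rows_other[symmetric]) simp
    also have "\<dots> \<le> flip_row j (i + 1) (flip_rows m j' x) (i + 1, 0)"
      using j by (intro flip_row_ge) auto
    also have "\<dots> = flip_rows m j x (i + 1, 0)"
      using i j j' flip_row_boundary[of j "i + 1" m] by simp
    finally show ?thesis by (simp add: H_def)
  qed
  have up: "H i j + x (i, j + 1) \<le> H i (j + 1)" if i: "1 \<le> i" "i \<le> m" for i j
  proof -
    let ?y = "flip_rows m j x"
    have "x (i, j + 1) = ?y (i, j + 1)"
      by (intro flip_rows_other[symmetric]) simp
    also have "\<dots> \<le> flip_row (j + 1) i ?y (0, j + 1)"
      using i by (intro flip_row_ge) auto
    also have "\<dots> = ?y (0, j + 1) + (\<Sum>k=1..i. flip_row (j + 1) i ?y (k, 0) - ?y (k, 0))"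
      using flip_row_conserve[of "j + 1" i ?y] by simp
    also have "?y (0, j + 1) = x (0, j + 1)"
      by (intro flip_rows_other) simp
    also have "(\<Sum>k=1..i. flip_row (j + 1) i ?y (k, 0) - ?y (k, 0))
        = (\<Sum>k=1..i. flip_rows m (j + 1) x (k, 0) - ?y (k, 0))"
      using i flip_row_boundary[of "j + 1" _ i ?y] flip_row_boundary[of "j + 1" _ m ?y]
      by (intro sum.cong) auto
    finally show ?thesis by (simp add: H_def sum_subtractf)
  qed
  have "x (1, 1) \<le> H 1 1"
    using right[of 0 1] mn x by (simp add: H_def)
  then have "last_passage x m n \<le> H m n"
    using mn right up by (intro last_passage_le) auto
  then show ?thesis by (simp add: H_def)
qed

lemma measurable_flip_row:
  assumes "1 \<le> j" "j \<le> n" "i \<le> m"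
  shows "flip_row j i \<in> (\<Pi>\<^sub>M z\<in>{..m} \<times> {..n} - {(0, 0)}. exp_law (r z)) \<rightarrow>\<^sub>M
    (\<Pi>\<^sub>M z\<in>{..m} \<times> {..n} - {(0, 0)}. exp_law (r z))"
  using assms(3)
proof (induction i)
  case (Suc i)
  then have "(\<lambda>x. flip (Suc i, 0) (0, j) (Suc i, j) (flip_row j i x))
      \<in> (\<Pi>\<^sub>M z\<in>{..m} \<times> {..n} - {(0, 0)}. exp_law (r z)) \<rightarrow>\<^sub>M
        (\<Pi>\<^sub>M z\<in>{..m} \<times> {..n} - {(0, 0)}. exp_law (r z))"
    using assms by (intro measurable_compose[OF _ measurable_flip]) auto
  then show ?case by simp
qed (simp add: measurable_ident[unfolded id_def] cong: measurable_cong)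

lemma nn_integral_flip_row:
  fixes r :: "nat \<times> nat \<Rightarrow> real"
  assumes j: "1 \<le> j" "j \<le> n" and i: "i \<le> m"
    and r: "\<And>z. 0 < r z" "\<And>i j. 1 \<le> i \<Longrightarrow> 1 \<le> j \<Longrightarrow> r (i, j) = r (i, 0) + r (0, j)"
    and f: "f \<in> borel_measurable (\<Pi>\<^sub>M z\<in>{..m} \<times> {..n} - {(0, 0)}. exp_law (r z))"
  shows "(\<integral>\<^sup>+x. f (flip_row j i x) \<partial>(\<Pi>\<^sub>M z\<in>{..m} \<times> {..n} - {(0, 0)}. exp_law (r z)))
    = (\<integral>\<^sup>+x. f x \<partial>(\<Pi>\<^sub>M z\<in>{..m} \<times> {..n} - {(0, 0)}. exp_law (r z)))"
  using i f
proof (induction i arbitrary: f)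
  case (Suc i)
  let ?P = "\<Pi>\<^sub>M z\<in>{..m} \<times> {..n} - {(0, 0)}. exp_law (r z)"
  let ?T = "flip (Suc i, 0) (0, j) (Suc i, j) :: (nat \<times> nat \<Rightarrow> real) \<Rightarrow> nat \<times> nat \<Rightarrow> real"
  have "(\<integral>\<^sup>+x. f (?T (flip_row j i x)) \<partial>?P) = (\<integral>\<^sup>+x. f (?T x) \<partial>?P)"
    using Suc.prems j by (intro Suc.IH measurable_compose[OF measurable_flip Suc.prems(2)]) auto
  also have "\<dots> = (\<integral>\<^sup>+x. f x \<partial>?P)"
    using Suc.prems j r by (intro nn_integral_flip) auto
  finally show ?case by simp
qed simp

lemma measurable_flip_rows:
  assumes "j \<le> n"
  shows "flip_rows m j \<in> (\<Pi>\<^sub>M z\<in>{..m} \<times> {..n} - {(0, 0)}. exp_law (r z)) \<rightarrow>\<^sub>M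
    (\<Pi>\<^sub>M z\<in>{..m} \<times> {..n} - {(0, 0)}. exp_law (r z))"
  using assms
proof (induction j)
  case (Suc j)
  then have "(\<lambda>x. flip_row (Suc j) m (flip_rows m j x))
      \<in> (\<Pi>\<^sub>M z\<in>{..m} \<times> {..n} - {(0, 0)}. exp_law (r z)) \<rightarrow>\<^sub>M
        (\<Pi>\<^sub>M z\<in>{..m} \<times> {..n} - {(0, 0)}. exp_law (r z))"
    by (intro measurable_compose[OF _ measurable_flip_row]) auto
  then show ?case by simp
qed (simp add: measurable_ident[unfolded id_def] cong: measurable_cong)

lemma nn_integral_flip_rows:
  fixes r :: "nat \<times> nat \<Rightarrow> real"
  assumes j: "j \<le> n"
    and r: "\<And>z. 0 < r z" "\<And>i j. 1 \<le> i \<Longrightarrow> 1 \<le> j \<Longrightarrow> r (i, j) = r (i, 0) + r (0, j)"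
    and f: "f \<in> borel_measurable (\<Pi>\<^sub>M z\<in>{..m} \<times> {..n} - {(0, 0)}. exp_law (r z))"
  shows "(\<integral>\<^sup>+x. f (flip_rows m j x) \<partial>(\<Pi>\<^sub>M z\<in>{..m} \<times> {..n} - {(0, 0)}. exp_law (r z)))
    = (\<integral>\<^sup>+x. f x \<partial>(\<Pi>\<^sub>M z\<in>{..m} \<times> {..n} - {(0, 0)}. exp_law (r z)))"
  using j f
proof (induction j arbitrary: f)
  case (Suc j)
  let ?P = "\<Pi>\<^sub>M z\<in>{..m} \<times> {..n} - {(0, 0)}. exp_law (r z)"
  have "(\<integral>\<^sup>+x. f (flip_row (Suc j) m (flip_rows m j x)) \<partial>?P) = (\<integral>\<^sup>+x. f (flip_row (Suc j) m x) \<partial>?P)"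
    using Suc.prems by (intro Suc.IH measurable_compose[OF measurable_flip_row Suc.prems(2)]) auto
  also have "\<dots> = (\<integral>\<^sup>+x. f x \<partial>?P)"
    using Suc.prems r by (intro nn_integral_flip_row) auto
  finally show ?case by simp
qed simp

section \<open>The mean of the last-passage time for fixed rates\<close>

lemma nn_integral_exp_law_PiM_component:
  assumes "\<And>z. 0 < r z" "z \<in> I"
  shows "(\<integral>\<^sup>+x. ennreal (x z) \<partial>(\<Pi>\<^sub>M z\<in>I. exp_law (r z))) = ennreal (1 / r z)"
proof -
  interpret product_prob_space "\<lambda>z. exp_law (r z)" I by (rule product_prob_space_exp_law[OF assms(1)])
  have "ennreal (1 / r z) = (\<integral>\<^sup>+x. ennreal x \<partial>distr (\<Pi>\<^sub>M z\<in>I. exp_law (r z)) (exp_law (r z)) (\<lambda>x. x z))"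
    by (simp add: PiM_component[OF assms(2)] nn_integral_exp_law_id[OF assms(1)])
  also have "\<dots> = (\<integral>\<^sup>+x. ennreal (x z) \<partial>(\<Pi>\<^sub>M z\<in>I. exp_law (r z)))"
    using assms(2) by (subst nn_integral_distr) auto
  finally show ?thesis by simp
qed

lemma nn_integral_last_passage_restrict:
  assumes "\<And>z. 0 < r z" "{1..m} \<times> {1..n} \<subseteq> I" "1 \<le> m" "1 \<le> n"
  shows "(\<integral>\<^sup>+W. ennreal (last_passage W m n) \<partial>(\<Pi>\<^sub>M z\<in>I. exp_law (r z)))
    = (\<integral>\<^sup>+W. ennreal (last_passage W m n) \<partial>(\<Pi>\<^sub>M z\<in>{1..m} \<times> {1..n}. exp_law (r z)))"
proof -
  let ?B = "{1..m} \<times> {1..n}"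
  interpret product_prob_space "\<lambda>z. exp_law (r z)" I by (rule product_prob_space_exp_law[OF assms(1)])
  have m: "(\<lambda>W. ennreal (last_passage W m n)) \<in> borel_measurable (\<Pi>\<^sub>M z\<in>?B. exp_law (r z))"
    using assms(3,4) by (intro measurable_compose[OF measurable_last_passage measurable_ennreal]) auto
  have "(\<integral>\<^sup>+W. ennreal (last_passage W m n) \<partial>(\<Pi>\<^sub>M z\<in>?B. exp_law (r z)))
      = (\<integral>\<^sup>+W. ennreal (last_passage W m n) \<partial>distr (\<Pi>\<^sub>M z\<in>I. exp_law (r z)) (\<Pi>\<^sub>M z\<in>?B. exp_law (r z)) (\<lambda>x. restrict x ?B))"
    using assms by (subst distr_PiM_restrict_finite) auto
  also have "\<dots> = (\<integral>\<^sup>+W. ennreal (last_passage (restrict W ?B) m n) \<partial>(\<Pi>\<^sub>M z\<in>I. exp_law (r z)))"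
    using m by (subst nn_integral_distr) (auto intro!: measurable_restrict_subset assms(2) simp del: One_nat_def)
  also have "\<dots> = (\<integral>\<^sup>+W. ennreal (last_passage W m n) \<partial>(\<Pi>\<^sub>M z\<in>I. exp_law (r z)))"
    by (intro nn_integral_cong arg_cong[where f = ennreal] last_passage_cong) simp
  finally show ?thesis by simp
qed

lemma quenched_law_eq:
  assumes "\<And>i j. 1 \<le> i \<Longrightarrow> 1 \<le> j \<Longrightarrow> r (i, j) = a i + b j"
  shows "quenched_law (a, b) = (\<Pi>\<^sub>M z\<in>{1..} \<times> {1..}. exp_law (r z))"
  unfolding quenched_law_def prod.case
  by (intro PiM_cong) (auto simp: exp_law_def assms)

text \<open>
  Only the law of a single coordinate after the sweep matters, and measure preservation makes it the
  original exponential law.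
\<close>

lemma nn_integral_last_passage_le:
  fixes a b :: "nat \<Rightarrow> real"
  assumes mn: "1 \<le> m" "1 \<le> n"
    and a: "\<And>i. 1 \<le> i \<Longrightarrow> 0 < a i" and b: "\<And>j. 1 \<le> j \<Longrightarrow> 0 < b j"
  shows "(\<integral>\<^sup>+W. ennreal (last_passage W m n) \<partial>quenched_law (a, b))
    \<le> (\<Sum>i=1..m. ennreal (1 / a i)) + (\<Sum>j=1..n. ennreal (1 / b j))"
proof -
  \<comment> \<open>The value at the origin is arbitrary; it only keeps all rates positive.\<close>
  define r where "r = (\<lambda>(i, j). if i = 0 \<and> j = 0 then 1
    else (if i = 0 then 0 else a i) + (if j = 0 then 0 else b j))"
  have r: "\<And>z. 0 < r z" "\<And>i j. 1 \<le> i \<Longrightarrow> 1 \<le> j \<Longrightarrow> r (i, j) = r (i, 0) + r (0, j)"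
    and ra: "\<And>i. 1 \<le> i \<Longrightarrow> r (i, 0) = a i" and rb: "\<And>j. 1 \<le> j \<Longrightarrow> r (0, j) = b j"
    using a b by (auto simp: r_def Suc_le_eq intro!: add_pos_pos)
  let ?I = "{..m} \<times> {..n} - {(0, 0)}"
  let ?P = "\<Pi>\<^sub>M z\<in>?I. exp_law (r z)"
  have "(\<integral>\<^sup>+W. ennreal (last_passage W m n) \<partial>quenched_law (a, b))
      = (\<integral>\<^sup>+W. ennreal (last_passage W m n) \<partial>(\<Pi>\<^sub>M z\<in>{1..} \<times> {1..}. exp_law (r z)))"
    by (subst quenched_law_eq[of r]) (auto simp: r_def)
  also have "\<dots> = (\<integral>\<^sup>+x. ennreal (last_passage x m n) \<partial>?P)"
    using mn by (subst (1 2) nn_integral_last_passage_restrict[OF r(1)]) auto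
  also have "\<dots> \<le> (\<integral>\<^sup>+x. (\<Sum>j=1..n. ennreal (x (0, j))) + (\<Sum>i=1..m. ennreal (flip_rows m n x (i, 0))) \<partial>?P)"
  proof (rule nn_integral_mono_AE)
    have "AE x in ?P. 0 \<le> x (0, 1)"
      using mn r(1) by (intro AE_PiM_component prob_space_exp_law AE_exp_law_nonneg) auto
    then show "AE x in ?P. ennreal (last_passage x m n)
        \<le> (\<Sum>j=1..n. ennreal (x (0, j))) + (\<Sum>i=1..m. ennreal (flip_rows m n x (i, 0)))"
    proof eventually_elim
      case (elim x)
      have sum_le: "ennreal (sum f A) \<le> (\<Sum>i\<in>A. ennreal (f i))" if "finite A" for f :: "nat \<Rightarrow> real" and A
        using that
      proof induction
        case (insert i A)
        have "ennreal (f i + sum f A) \<le> ennreal (max 0 (f i) + max 0 (sum f A))"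
          by (intro ennreal_leI) simp
        also have "\<dots> = ennreal (f i) + ennreal (sum f A)"
          by (simp add: ennreal_plus max_def ennreal_neg)
        also have "\<dots> \<le> ennreal (f i) + (\<Sum>i\<in>A. ennreal (f i))"
          by (intro add_left_mono insert.IH)
        finally show ?case
          using insert.hyps by simp
      qed simp
      have "ennreal (last_passage x m n)
          \<le> ennreal (max 0 (\<Sum>j=1..n. x (0, j)) + max 0 (\<Sum>i=1..m. flip_rows m n x (i, 0)))"
        using last_passage_le_flip_rows[of m n x, OF mn elim] by (intro ennreal_leI) simp
      also have "\<dots> = ennreal (\<Sum>j=1..n. x (0, j)) + ennreal (\<Sum>i=1..m. flip_rows m n x (i, 0))"
        by (simp add: ennreal_plus max_def ennreal_neg)
      also have "\<dots> \<le> (\<Sum>j=1..n. ennreal (x (0, j))) + (\<Sum>i=1..m. ennreal (flip_rows m n x (i, 0)))"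
        by (intro add_mono sum_le) simp_all
      finally show ?case .
    qed
  qed
  also have "\<dots> = (\<Sum>j=1..n. \<integral>\<^sup>+x. ennreal (x (0, j)) \<partial>?P)
      + (\<Sum>i=1..m. \<integral>\<^sup>+x. ennreal (flip_rows m n x (i, 0)) \<partial>?P)"
  proof -
    have comp: "(\<lambda>x. ennreal (x z)) \<in> borel_measurable ?P" if "z \<in> ?I" for z
      using measurable_component_singleton[of z ?I "\<lambda>z. exp_law (r z)"] that
      by (simp cong: measurable_cong_sets)
    have 1: "(\<lambda>x. ennreal (x (0, j))) \<in> borel_measurable ?P" if "j \<in> {1..n}" for j
      using that by (intro comp) auto
    have 2: "(\<lambda>x. ennreal (flip_rows m n x (i, 0))) \<in> borel_measurable ?P" if "i \<in> {1..m}" for i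
      using that by (intro measurable_compose[OF measurable_flip_rows comp]) auto
    show ?thesis
      by (subst nn_integral_add, (intro borel_measurable_sum 1 2; assumption)+)
        (simp only: nn_integral_sum 1 2)
  qed
  also have "(\<Sum>j=1..n. \<integral>\<^sup>+x. ennreal (x (0, j)) \<partial>?P) = (\<Sum>j=1..n. ennreal (1 / b j))"
    using rb by (intro sum.cong refl) (subst nn_integral_exp_law_PiM_component[OF r(1)], auto)
  also have "(\<Sum>i=1..m. \<integral>\<^sup>+x. ennreal (flip_rows m n x (i, 0)) \<partial>?P) = (\<Sum>i=1..m. ennreal (1 / a i))"
  proof (intro sum.cong refl)
    fix i assume i: "i \<in> {1..m}"
    have "(\<lambda>x. ennreal (x (i, 0))) \<in> borel_measurable ?P"
      using measurable_component_singleton[of "(i, 0)" ?I "\<lambda>z. exp_law (r z)"] i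
      by (simp cong: measurable_cong_sets)
    then have "(\<integral>\<^sup>+x. ennreal (flip_rows m n x (i, 0)) \<partial>?P) = (\<integral>\<^sup>+x. ennreal (x (i, 0)) \<partial>?P)"
      using r by (intro nn_integral_flip_rows[where f = "\<lambda>x. ennreal (x (i, 0))"]) auto
    also have "\<dots> = ennreal (1 / a i)"
      using i ra by (subst nn_integral_exp_law_PiM_component[OF r(1)]) auto
    finally show "(\<integral>\<^sup>+x. ennreal (flip_rows m n x (i, 0)) \<partial>?P) = ennreal (1 / a i)" .
  qed
  finally show ?thesis by (simp add: add.commute)
qed

section \<open>Lower deviations for fixed rates\<close>

text \<open>
  A Chernoff bound. Lowering the rates stochastically increases the exponential variables, so the bound may be
  stated with upper bounds \<open>\<rho>\<close> on the rates; these will be bounded below, which the rates need not be.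
\<close>

lemma exp_sum_lower_tail:
  fixes r \<rho> :: "'i \<Rightarrow> real"
  assumes r: "\<And>z. 0 < r z" and S: "finite S" "S \<subseteq> I" and \<rho>: "\<And>z. z \<in> S \<Longrightarrow> r z \<le> \<rho> z" and l: "0 < l"
  shows "emeasure (\<Pi>\<^sub>M z\<in>I. exp_law (r z))
      {W \<in> space (\<Pi>\<^sub>M z\<in>I. exp_law (r z)). (\<Sum>z\<in>S. W z) \<le> (\<Sum>z\<in>S. 1 / \<rho> z) - t}
    \<le> ennreal (exp (l\<^sup>2 * (\<Sum>z\<in>S. (1 / \<rho> z)\<^sup>2) - l * t))"
proof -
  interpret product_prob_space "\<lambda>z. exp_law (r z)" I by (rule product_prob_space_exp_law[OF r])
  let ?P = "\<Pi>\<^sub>M z\<in>I. exp_law (r z)"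
  have exp_m: "(\<lambda>x. ennreal (exp (- (l * x)))) \<in> borel_measurable (exp_law s)" for s
    by measurable
  have comp: "(\<lambda>W. W z) \<in> borel_measurable (\<Pi>\<^sub>M z\<in>J. exp_law (r z))" if "z \<in> J" for z J
    using measurable_component_singleton[of z J "\<lambda>z. exp_law (r z)"] that
    by (auto cong: measurable_cong_sets)
  have [measurable]: "(\<lambda>W. W z) \<in> borel_measurable ?P"
      "(\<lambda>W. W z) \<in> borel_measurable (\<Pi>\<^sub>M z\<in>S. exp_law (r z))" if "z \<in> S" for z
    using that S by (auto intro!: comp)
  have [measurable]: "(\<lambda>W. \<Prod>z\<in>S. ennreal (exp (- (l * W z)))) \<in> borel_measurable (\<Pi>\<^sub>M z\<in>S. exp_law (r z))"
    by measurable
  have laplace_le: "r z / (r z + l) \<le> exp (l\<^sup>2 * (1 / \<rho> z)\<^sup>2 - l * (1 / \<rho> z))" if "z \<in> S" for z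
  proof -
    have pos: "0 < \<rho> z" using r[of z] \<rho>[OF that] by simp
    define u where "u = l / \<rho> z"
    have u: "0 \<le> u" using l pos by (simp add: u_def)
    have "r z / (r z + l) \<le> \<rho> z / (\<rho> z + l)"
      using r[of z] \<rho>[OF that] pos l by (simp add: divide_simps algebra_simps mult_left_mono)
    also have "\<dots> = 1 / (1 + u)"
      using pos l by (simp add: u_def field_simps)
    also have "\<dots> \<le> 1 + (u\<^sup>2 - u)"
      using u by (simp add: divide_simps algebra_simps power2_eq_square)
    also have "\<dots> \<le> exp (u\<^sup>2 - u)"
      by (rule exp_ge_add_one_self)
    finally show ?thesis by (simp add: u_def power_divide)
  qed
  have laplace: "(\<integral>\<^sup>+W. (\<Prod>z\<in>S. ennreal (exp (- (l * W z)))) \<partial>?P)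
      \<le> ennreal (exp (l\<^sup>2 * (\<Sum>z\<in>S. (1 / \<rho> z)\<^sup>2) - l * (\<Sum>z\<in>S. 1 / \<rho> z)))"
  proof -
    have "(\<integral>\<^sup>+W. (\<Prod>z\<in>S. ennreal (exp (- (l * W z)))) \<partial>?P)
        = (\<integral>\<^sup>+W. (\<Prod>z\<in>S. ennreal (exp (- (l * restrict W S z)))) \<partial>?P)"
      by simp
    also have "\<dots> = (\<integral>\<^sup>+W. (\<Prod>z\<in>S. ennreal (exp (- (l * W z)))) \<partial>distr ?P (\<Pi>\<^sub>M z\<in>S. exp_law (r z)) (\<lambda>W. restrict W S))"
      using S by (subst nn_integral_distr) (auto intro!: measurable_restrict_subset)
    also have "\<dots> = (\<integral>\<^sup>+W. (\<Prod>z\<in>S. ennreal (exp (- (l * W z)))) \<partial>(\<Pi>\<^sub>M z\<in>S. exp_law (r z)))"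
      using S by (subst distr_PiM_restrict_finite) auto
    also have "\<dots> = (\<Prod>z\<in>S. \<integral>\<^sup>+x. ennreal (exp (- (l * x))) \<partial>exp_law (r z))"
      using S by (intro product_nn_integral_prod[where f = "\<lambda>_ x. ennreal (exp (- (l * x)))"] exp_m)
    also have "\<dots> = (\<Prod>z\<in>S. ennreal (r z / (r z + l)))"
      by (simp add: nn_integral_exp_law_laplace r less_imp_le[OF l])
    also have "\<dots> \<le> (\<Prod>z\<in>S. ennreal (exp (l\<^sup>2 * (1 / \<rho> z)\<^sup>2 - l * (1 / \<rho> z))))"
      using r l laplace_le
      by (subst (1 2) prod_ennreal) (auto intro!: ennreal_leI prod_mono less_imp_le[OF add_pos_nonneg] divide_nonneg_nonneg less_imp_le[OF r])
    also have "\<dots> = ennreal (exp (\<Sum>z\<in>S. l\<^sup>2 * (1 / \<rho> z)\<^sup>2 - l * (1 / \<rho> z)))"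
      using S by (simp add: prod_ennreal exp_sum)
    also have "(\<Sum>z\<in>S. l\<^sup>2 * (1 / \<rho> z)\<^sup>2 - l * (1 / \<rho> z))
        = l\<^sup>2 * (\<Sum>z\<in>S. (1 / \<rho> z)\<^sup>2) - l * (\<Sum>z\<in>S. 1 / \<rho> z)"
      by (simp only: sum_subtractf sum_distrib_left)
    finally show ?thesis .
  qed
  define c where "c = (\<Sum>z\<in>S. 1 / \<rho> z) - t"
  have "emeasure ?P {W \<in> space ?P. (\<Sum>z\<in>S. W z) \<le> c}
      \<le> ennreal (exp (l * c)) * (\<integral>\<^sup>+W. ennreal (exp (- l * (\<Sum>z\<in>S. W z))) * indicator (space ?P) W \<partial>?P)"
    using l by (intro Chernoff_ineq_nn_integral_le) auto
  also have "(\<integral>\<^sup>+W. ennreal (exp (- l * (\<Sum>z\<in>S. W z))) * indicator (space ?P) W \<partial>?P)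
      = (\<integral>\<^sup>+W. (\<Prod>z\<in>S. ennreal (exp (- (l * W z)))) \<partial>?P)"
    using S by (intro nn_integral_cong) (simp add: prod_ennreal exp_sum[symmetric] sum_negf sum_distrib_left)
  also have "ennreal (exp (l * c)) * \<dots> \<le> ennreal (exp (l * c)) * ennreal (exp (l\<^sup>2 * (\<Sum>z\<in>S. (1 / \<rho> z)\<^sup>2) - l * (\<Sum>z\<in>S. 1 / \<rho> z)))"
    by (intro mult_left_mono laplace) simp
  also have "\<dots> = ennreal (exp (l\<^sup>2 * (\<Sum>z\<in>S. (1 / \<rho> z)\<^sup>2) - l * t))"
    by (simp add: ennreal_mult[symmetric] exp_add[symmetric] c_def algebra_simps)
  finally show ?thesis by (simp add: c_def)
qed

lemma tendsto_nat_floor_ratio: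
  assumes "0 \<le> u"
  shows "(\<lambda>n. real (nat \<lfloor>real n * u\<rfloor>) / real n) \<longlonglongrightarrow> u"
proof (rule tendsto_sandwich)
  show "\<forall>\<^sub>F n in sequentially. u - 1 / real n \<le> real (nat \<lfloor>real n * u\<rfloor>) / real n"
    using eventually_gt_at_top[of 0]
  proof eventually_elim
    case (elim n)
    then have "(real n * u - 1) / real n \<le> real (nat \<lfloor>real n * u\<rfloor>) / real n"
      using assms by (intro divide_right_mono) (auto simp: floor_le_iff; linarith)+
    then show ?case using elim by (simp add: diff_divide_distrib)
  qed
  show "\<forall>\<^sub>F n in sequentially. real (nat \<lfloor>real n * u\<rfloor>) / real n \<le> u"
    using eventually_gt_at_top[of 0]
  proof eventually_elim
    case (elim n)
    have "real (nat \<lfloor>real n * u\<rfloor>) / real n \<le> (real n * u) / real n"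
      using assms by (intro divide_right_mono) auto
    then show ?case using elim by simp
  qed
  show "(\<lambda>n. u - 1 / real n) \<longlonglongrightarrow> u"
    using tendsto_diff[OF tendsto_const lim_1_over_n] by simp
qed simp

lemma filterlim_nat_floor_mult:
  assumes "0 < u"
  shows "filterlim (\<lambda>n. nat \<lfloor>real n * u\<rfloor>) at_top sequentially"
proof -
  have "filterlim (\<lambda>n. real n * u) at_top sequentially"
    using filterlim_tendsto_pos_mult_at_top[OF tendsto_const assms filterlim_real_sequentially]
    by (simp add: mult.commute)
  then show ?thesis
    by (intro filterlim_compose[OF filterlim_nat_sequentially] filterlim_compose[OF filterlim_floor_sequentially])
qed

lemma average_tendsto_floor:
  fixes f :: "nat \<Rightarrow> real"
  assumes "(\<lambda>n. (\<Sum>i=1..n. f i) / real n) \<longlonglongrightarrow> A" and u: "0 < u"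
  shows "(\<lambda>n. (\<Sum>i=1..nat \<lfloor>real n * u\<rfloor>. f i) / real n) \<longlonglongrightarrow> u * A"
proof -
  let ?k = "\<lambda>n. nat \<lfloor>real n * u\<rfloor>"
  have "(\<lambda>n. (real (?k n) / real n) * ((\<Sum>i=1..?k n. f i) / real (?k n))) \<longlonglongrightarrow> u * A"
    using u by (intro tendsto_mult tendsto_nat_floor_ratio filterlim_compose[OF assms(1)] filterlim_nat_floor_mult) auto
  then show ?thesis
  proof (rule Lim_transform_eventually)
    show "\<forall>\<^sub>F n in sequentially. (real (?k n) / real n) * ((\<Sum>i=1..?k n. f i) / real (?k n))
        = (\<Sum>i=1..?k n. f i) / real n"
      using filterlim_nat_floor_mult[OF u, unfolded filterlim_at_top, rule_format, of 1]
      by eventually_elim simp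
  qed
qed

lemma AE_exp_law_PiM_nonneg:
  assumes "\<And>z. 0 < r z" "countable I"
  shows "AE W in (\<Pi>\<^sub>M z\<in>I. exp_law (r z)). \<forall>z\<in>I. 0 \<le> W z"
  using assms by (subst AE_ball_countable) 
    (auto intro!: AE_PiM_component prob_space_exp_law AE_exp_law_nonneg)

text \<open>
  A positive limiting frequency forces an occurrence in every interval whose length is
  proportional to \<open>n\<close>.
\<close>

lemma eventually_exists_small:
  fixes a :: "nat \<Rightarrow> real"
  assumes p: "(\<lambda>n. (\<Sum>i=1..n. if a i \<le> \<epsilon> then 1 else 0) / real n) \<longlonglongrightarrow> p" "0 < p"
    and "0 < u" "u < s"
  shows "\<forall>\<^sub>F n in sequentially. \<exists>i. nat \<lfloor>real n * u\<rfloor> < i \<and> i \<le> nat \<lfloor>real n * s\<rfloor> \<and> a i \<le> \<epsilon>"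
proof -
  let ?f = "\<lambda>i. if a i \<le> \<epsilon> then 1 else 0 :: real"
  have "(\<lambda>n. (\<Sum>i=1..nat \<lfloor>real n * s\<rfloor>. ?f i) / real n - (\<Sum>i=1..nat \<lfloor>real n * u\<rfloor>. ?f i) / real n)
      \<longlonglongrightarrow> s * p - u * p"
    using assms by (intro tendsto_diff average_tendsto_floor) auto
  moreover have "0 < s * p - u * p"
    using assms by simp
  ultimately have "\<forall>\<^sub>F n in sequentially. 0 < (\<Sum>i=1..nat \<lfloor>real n * s\<rfloor>. ?f i) / real n
      - (\<Sum>i=1..nat \<lfloor>real n * u\<rfloor>. ?f i) / real n"
    by (rule order_tendstoD)
  then show ?thesis
    using eventually_gt_at_top[of 0]
  proof eventually_elim
    case (elim n)
    let ?k = "nat \<lfloor>real n * u\<rfloor>" and ?m = "nat \<lfloor>real n * s\<rfloor>"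
    have "(\<Sum>i=1..?k. ?f i) < (\<Sum>i=1..?m. ?f i)"
      using elim by (simp add: diff_divide_distrib[symmetric] zero_less_divide_iff)
    moreover have "(\<Sum>i=1..?m. ?f i) \<le> (\<Sum>i=1..?k. ?f i)" if "\<And>i. ?k < i \<Longrightarrow> i \<le> ?m \<Longrightarrow> \<not> a i \<le> \<epsilon>"
    proof -
      have "(\<Sum>i=1..?m. ?f i) = (\<Sum>i\<in>{1..?m} \<inter> {..?k}. ?f i)"
        using that by (intro sum.mono_neutral_right) (auto simp: not_le)
      also have "\<dots> \<le> (\<Sum>i=1..?k. ?f i)"
        by (intro sum_mono2) auto
      finally show ?thesis .
    qed
    ultimately show ?case by (meson not_le)
  qed
qed

definition corner_sites :: "nat \<Rightarrow> nat \<Rightarrow> nat \<Rightarrow> (nat \<times> nat) set" where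
  "corner_sites i j n = (\<lambda>k. (k, j)) ` {1..i} \<union> (\<lambda>l. (i, l)) ` {j+1..n}"

lemma sum_corner_sites:
  "(\<Sum>z\<in>corner_sites i j n. f z) = (\<Sum>k=1..i. f (k, j)) + (\<Sum>l=j+1..n. f (i, l))"
  unfolding corner_sites_def
  by (subst sum.union_disjoint) (auto simp: sum.reindex inj_on_def)

text \<open>
  The column can be found only to the right of \<open>u n\<close> with \<open>u < s\<close>, whence the factor \<open>u\<close> in place of
  \<open>s\<close>. As \<open>a k + b j \<le> a k + \<epsilon>\<close> on the chosen row, and symmetrically on the chosen column, the Chernoff
  bound applies with the rates \<open>\<rho> \<ge> \<epsilon>\<close> and gives exponentially small failure probabilities, which
  are summable.
\<close>

lemma quenched_lower_bound:
  fixes a b :: "nat \<Rightarrow> real"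
  assumes pos: "\<And>i. 1 \<le> i \<Longrightarrow> 0 < a i" "\<And>j. 1 \<le> j \<Longrightarrow> 0 < b j" and \<epsilon>: "0 < \<epsilon>"
    and A: "(\<lambda>n. (\<Sum>i=1..n. 1 / (a i + \<epsilon>)) / real n) \<longlonglongrightarrow> A"
    and B: "(\<lambda>n. (\<Sum>j=1..n. 1 / (b j + \<epsilon>)) / real n) \<longlonglongrightarrow> B"
    and p: "(\<lambda>n. (\<Sum>i=1..n. if a i \<le> \<epsilon> then 1 else 0) / real n) \<longlonglongrightarrow> p" "0 < p"
    and j: "1 \<le> j" "b j \<le> \<epsilon>"
    and u: "0 < u" "u < s" and t: "0 < t" and c: "c < u * A + t * B"
  shows "AE W in quenched_law (a, b). \<forall>\<^sub>F n in sequentially.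
    c \<le> last_passage W (nat \<lfloor>real n * s\<rfloor>) (nat \<lfloor>real n * t\<rfloor>) / real n"
proof -
  define r where "r = (\<lambda>(i, j). if 1 \<le> i \<and> 1 \<le> j then a i + b j else 1)"
  have r: "0 < r z" for z
    using pos by (auto simp: r_def intro!: add_pos_pos split: prod.split)
  let ?P = "\<Pi>\<^sub>M z\<in>{1..} \<times> {1..}. exp_law (r z)"
  interpret product_prob_space "\<lambda>z. exp_law (r z)" "{1..} \<times> {1..}" by (rule product_prob_space_exp_law[OF r])
  have P: "quenched_law (a, b) = ?P"
    by (rule quenched_law_eq) (auto simp: r_def)
  define k where "k = (\<lambda>n::nat. nat \<lfloor>real n * u\<rfloor>)"
  define m where "m = (\<lambda>n::nat. nat \<lfloor>real n * s\<rfloor>)"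
  define N where "N = (\<lambda>n::nat. nat \<lfloor>real n * t\<rfloor>)"
  define \<eta> where "\<eta> = (u * A + t * B - c) / 2"
  have \<eta>: "0 < \<eta>" using c by (simp add: \<eta>_def)
  have "(\<lambda>n. (\<Sum>i=1..k n. 1 / (a i + \<epsilon>)) / real n + (\<Sum>j=1..N n. 1 / (b j + \<epsilon>)) / real n
      - (real j / \<epsilon>) * (1 / real n)) \<longlonglongrightarrow> u * A + t * B - (real j / \<epsilon>) * 0"
    unfolding k_def N_def using A B u t
    by (intro tendsto_diff tendsto_add average_tendsto_floor tendsto_mult tendsto_const lim_1_over_n) auto
  moreover have "c + \<eta> < u * A + t * B - (real j / \<epsilon>) * 0"
    using c by (simp add: \<eta>_def field_simps)
  ultimately have "\<forall>\<^sub>F n in sequentially. c + \<eta> < (\<Sum>i=1..k n. 1 / (a i + \<epsilon>)) / real n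
      + (\<Sum>j=1..N n. 1 / (b j + \<epsilon>)) / real n - (real j / \<epsilon>) * (1 / real n)"
    by (rule order_tendstoD)
  moreover have "\<forall>\<^sub>F n in sequentially. \<exists>i. k n < i \<and> i \<le> m n \<and> a i \<le> \<epsilon>"
    unfolding k_def m_def using p u by (rule eventually_exists_small)
  moreover have "\<forall>\<^sub>F n in sequentially. j \<le> N n"
    using filterlim_nat_floor_mult[OF t] by (simp add: N_def filterlim_at_top)
  ultimately have "\<forall>\<^sub>F n in sequentially. 0 < n \<and> j \<le> N n \<and> (\<exists>i. k n < i \<and> i \<le> m n \<and> a i \<le> \<epsilon>) \<and>
      c + \<eta> < (\<Sum>i=1..k n. 1 / (a i + \<epsilon>)) / real n
      + (\<Sum>j=1..N n. 1 / (b j + \<epsilon>)) / real n - (real j / \<epsilon>) * (1 / real n)"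
    using eventually_gt_at_top[of 0] by eventually_elim blast
  then obtain n0 where n0: "\<And>n. n0 \<le> n \<Longrightarrow> 0 < n \<and> j \<le> N n \<and> (\<exists>i. k n < i \<and> i \<le> m n \<and> a i \<le> \<epsilon>) \<and>
      c + \<eta> < (\<Sum>i=1..k n. 1 / (a i + \<epsilon>)) / real n
      + (\<Sum>j=1..N n. 1 / (b j + \<epsilon>)) / real n - (real j / \<epsilon>) * (1 / real n)"
    by (auto simp: eventually_sequentially)
  define i where "i = (\<lambda>n. SOME i. k n < i \<and> i \<le> m n \<and> a i \<le> \<epsilon>)"
  have i: "k n < i n" "i n \<le> m n" "a (i n) \<le> \<epsilon>" if "n0 \<le> n" for n
    using someI_ex[of "\<lambda>i. k n < i \<and> i \<le> m n \<and> a i \<le> \<epsilon>"] n0[OF that] unfolding i_def by blast+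
  define \<rho> where "\<rho> = (\<lambda>(i, l). (if l = j then a i else b l) + \<epsilon>)"
  define S where "S = (\<lambda>n. corner_sites (i n) j (N n))"
  have S: "finite (S n)" "S n \<subseteq> {1..} \<times> {1..}" if "n0 \<le> n" for n
    using i(1)[OF that] j by (auto simp: S_def corner_sites_def)
  have r_le: "r z \<le> \<rho> z" if "n0 \<le> n" "z \<in> S n" for n z
    using S[OF that(1)] that i[OF that(1)] j by (auto simp: S_def corner_sites_def r_def \<rho>_def)
  have mean: "real n * (c + \<eta>) \<le> (\<Sum>z\<in>S n. 1 / \<rho> z)" if n: "n0 \<le> n" for n
  proof -
    have "real n * (c + \<eta>) \<le> (\<Sum>i=1..k n. 1 / (a i + \<epsilon>)) + (\<Sum>j=1..N n. 1 / (b j + \<epsilon>)) - real j / \<epsilon>"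
    proof -
      have "c + \<eta> < ((\<Sum>i=1..k n. 1 / (a i + \<epsilon>)) + (\<Sum>j=1..N n. 1 / (b j + \<epsilon>)) - real j / \<epsilon>) / real n"
        using n0[OF n] by (simp add: add_divide_distrib diff_divide_distrib)
      then show ?thesis
        using n0[OF n] by (simp add: pos_less_divide_eq mult.commute)
    qed
    also have "(\<Sum>i=1..k n. 1 / (a i + \<epsilon>)) \<le> (\<Sum>i=1..i n. 1 / (a i + \<epsilon>))"
    proof (rule sum_mono2)
      show "0 \<le> 1 / (a l + \<epsilon>)" if "l \<in> {1..i n} - {1..k n}" for l
        using pos(1)[of l] that \<epsilon> by simp
    qed (use i(1)[OF n] in auto)
    also have "(\<Sum>j=1..N n. 1 / (b j + \<epsilon>)) = (\<Sum>l=1..j. 1 / (b l + \<epsilon>)) + (\<Sum>l=j+1..N n. 1 / (b l + \<epsilon>))"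
      using sum.ub_add_nat[of 1 j "\<lambda>l. 1 / (b l + \<epsilon>)" "N n - j"] n0[OF n] j by simp
    \<comment> \<open>The climb starts above row \<open>j\<close>; what it omits does not depend on \<open>n\<close>.\<close>
    also have "(\<Sum>l=1..j. 1 / (b l + \<epsilon>)) \<le> (\<Sum>l=1..j. 1 / \<epsilon>)"
      using pos(2) \<epsilon> by (intro sum_mono divide_left_mono) (auto intro!: mult_pos_pos add_pos_pos less_imp_le)
    also have "(\<Sum>i=1..i n. 1 / (a i + \<epsilon>)) + ((\<Sum>l=1..j. 1 / \<epsilon>) + (\<Sum>l=j+1..N n. 1 / (b l + \<epsilon>))) - real j / \<epsilon>
        = (\<Sum>z\<in>S n. 1 / \<rho> z)"
      by (simp add: S_def sum_corner_sites \<rho>_def)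
    finally show ?thesis by simp
  qed
  have var: "(\<Sum>z\<in>S n. (1 / \<rho> z)\<^sup>2) \<le> real n * ((s + t) / \<epsilon>\<^sup>2)" if n: "n0 \<le> n" for n
  proof -
    have "(1 / \<rho> z)\<^sup>2 \<le> 1 / \<epsilon>\<^sup>2" if "z \<in> S n" for z
    proof -
      have "\<epsilon> \<le> \<rho> z"
        using S[OF n] that pos by (auto simp: \<rho>_def less_imp_le split: prod.split)
      then have "1 / \<rho> z \<le> 1 / \<epsilon>" "0 \<le> 1 / \<rho> z" using \<epsilon> by (auto simp: frac_le)
      then show ?thesis using power_mono[of "1 / \<rho> z" "1 / \<epsilon>" 2] by (simp add: power_divide)
    qed
    then have "(\<Sum>z\<in>S n. (1 / \<rho> z)\<^sup>2) \<le> (\<Sum>z\<in>S n. 1 / \<epsilon>\<^sup>2)"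
      by (rule sum_mono)
    also have "\<dots> = (real (i n) + real (N n - j)) * (1 / \<epsilon>\<^sup>2)"
      by (simp add: S_def sum_corner_sites algebra_simps del: sum_constant) (simp add: field_simps)
    also have "\<dots> \<le> (real n * s + real n * t) * (1 / \<epsilon>\<^sup>2)"
    proof (intro mult_right_mono add_mono)
      have "real (i n) \<le> real (m n)" using i(2)[OF n] by simp
      also have "\<dots> \<le> real n * s" using u by (simp add: m_def)
      finally show "real (i n) \<le> real n * s" .
      have "real (N n - j) \<le> real (N n)" by simp
      also have "\<dots> \<le> real n * t" using t by (simp add: N_def)
      finally show "real (N n - j) \<le> real n * t" .
    qed simp
    finally show ?thesis by (simp add: algebra_simps add_divide_distrib)
  qed
  define D where "D = (s + t) / \<epsilon>\<^sup>2"
  have D: "0 < D" using u t \<epsilon> by (simp add: D_def)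
  \<comment> \<open>The minimizer over \<open>l\<close> of the exponent \<open>l\<^sup>2 D - l \<eta>\<close> of the Chernoff bound.\<close>
  define l where "l = \<eta> / (2 * D)"
  have l: "0 < l" using \<eta> D by (simp add: l_def)
  define bad where "bad = (\<lambda>n. {W \<in> space ?P. n0 \<le> n \<and> (\<Sum>z\<in>S n. W z) \<le> (\<Sum>z\<in>S n. 1 / \<rho> z) - real n * \<eta>})"
  have bad_sets: "bad n \<in> sets ?P" for n
  proof (cases "n0 \<le> n")
    case True
    have "(\<lambda>W. W z) \<in> borel_measurable ?P" if "z \<in> S n" for z
      using measurable_component_singleton[of z "{1..} \<times> {1..}" "\<lambda>z. exp_law (r z)"] that S(2)[OF True]
      by (auto cong: measurable_cong_sets)
    then have [measurable]: "(\<lambda>W. \<Sum>z\<in>S n. W z) \<in> borel_measurable ?P"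
      by (rule borel_measurable_sum)
    show ?thesis unfolding bad_def by measurable
  qed (simp add: bad_def)
  have bad_le: "measure ?P (bad n) \<le> exp (- (l * \<eta> / 2)) ^ n" for n
  proof (cases "n0 \<le> n")
    case True
    have "emeasure ?P (bad n) \<le> ennreal (exp (l\<^sup>2 * (\<Sum>z\<in>S n. (1 / \<rho> z)\<^sup>2) - l * (real n * \<eta>)))"
      unfolding bad_def using exp_sum_lower_tail[OF r S[OF True] r_le[OF True] l, where t = "real n * \<eta>"] True by simp
    also have "\<dots> \<le> ennreal (exp (l\<^sup>2 * (real n * D) - l * (real n * \<eta>)))"
      using mult_left_mono[OF var[OF True], of "l\<^sup>2"] by (intro ennreal_leI) (simp add: D_def)
    also have "l\<^sup>2 * (real n * D) - l * (real n * \<eta>) = real n * (- (l * \<eta> / 2))"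
    proof -
      have "l * D = \<eta> / 2" using D by (simp add: l_def)
      then have "l\<^sup>2 * (real n * D) = l * real n * (\<eta> / 2)"
        by (simp add: power2_eq_square mult.assoc mult.left_commute[of D] mult.commute[of D])
      then show ?thesis by (simp add: algebra_simps)
    qed
    also have "exp \<dots> = exp (- (l * \<eta> / 2)) ^ n"
      by (rule exp_of_nat_mult)
    finally show ?thesis
      unfolding P.emeasure_eq_measure by (simp add: ennreal_le_iff)
  qed (simp add: bad_def)
  have "summable (\<lambda>n. measure ?P (bad n))"
  proof (rule summable_comparison_test')
    show "summable (\<lambda>n. exp (- (l * \<eta> / 2)) ^ n)"
      using l \<eta> by (intro summable_geometric) simp
    show "norm (measure ?P (bad n)) \<le> exp (- (l * \<eta> / 2)) ^ n" if "0 \<le> n" for n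
      using bad_le by simp
  qed
  then have "AE W in ?P. \<forall>\<^sub>F n in sequentially. W \<in> space ?P - bad n"
    by (intro borel_cantelli_AE1 bad_sets) (simp_all add: P.emeasure_eq_measure del: One_nat_def)
  moreover have "AE W in ?P. \<forall>z\<in>{1..} \<times> {1..}. 0 \<le> W z"
    by (rule AE_exp_law_PiM_nonneg[OF r]) simp
  ultimately show ?thesis
    unfolding P
  proof eventually_elim
    case (elim W)
    from elim(1) eventually_ge_at_top[of n0] show ?case
    proof eventually_elim
      case (elim n)
      have "real n * c \<le> (\<Sum>z\<in>S n. 1 / \<rho> z) - real n * \<eta>"
        using mean[OF elim(2)] by (simp add: algebra_simps)
      also have "\<dots> \<le> (\<Sum>z\<in>S n. W z)"
        using elim by (auto simp: bad_def)
      also have "\<dots> \<le> last_passage W (m n) (N n)"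
        unfolding S_def sum_corner_sites
        using i[OF elim(2)] n0[OF elim(2)] j \<open>\<forall>z\<in>{1..} \<times> {1..}. 0 \<le> W z\<close>
        by (intro last_passage_ge_corner_path) auto
      finally show ?case
        using n0[OF elim(2)] by (simp add: m_def N_def field_simps)
    qed
  qed
qed

section \<open>An ergodic theorem for bounded functions\<close>

text \<open>
  The maximum of \<open>0\<close> and the ergodic sums of \<open>g\<close> of length at most \<open>n\<close>; the recursive form is what
  the proof of the ergodic theorem uses.
\<close>

fun max_sum :: "('a \<Rightarrow> 'a) \<Rightarrow> ('a \<Rightarrow> real) \<Rightarrow> nat \<Rightarrow> 'a \<Rightarrow> real" where
  "max_sum T g 0 x = 0"
| "max_sum T g (Suc n) x = max 0 (g x + max_sum T g n (T x))"

lemma max_sum_nonneg: "0 \<le> max_sum T g n x"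
  by (cases n) auto

lemma max_sum_mono_Suc: "max_sum T g n x \<le> max_sum T g (Suc n) x"
proof (induction n arbitrary: x)
  case (Suc n)
  then show ?case
    unfolding max_sum.simps(2)[of T g "Suc n"] max_sum.simps(2)[of T g n x]
    by (intro max.mono add_left_mono order_refl)
qed simp

lemma max_sum_mono: "n \<le> m \<Longrightarrow> max_sum T g n x \<le> max_sum T g m x"
  by (rule lift_Suc_mono_le[of "\<lambda>n. max_sum T g n x"]) (rule max_sum_mono_Suc)

lemma sum_le_max_sum: "(\<Sum>k<n. g ((T ^^ k) x)) \<le> max_sum T g n x"
proof (induction n arbitrary: x)
  case (Suc n)
  have "(\<Sum>k<Suc n. g ((T ^^ k) x)) = g x + (\<Sum>k<n. g ((T ^^ k) (T x)))"
    by (simp add: sum.lessThan_Suc_shift funpow_swap1 del: sum.lessThan_Suc)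
  with Suc[of "T x"] show ?case by simp
qed simp

text \<open>
  With \<open>g = - f\<close> and \<open>m\<^sub>n\<close> the running maxima of the sums of \<open>g\<close>, the set \<open>A\<close> where \<open>m\<^sub>n\<close> is unbounded
  is invariant. If it had probability \<open>1\<close>, then \<open>m\<^sub>n\<^sub>+\<^sub>1 - m\<^sub>n \<circ> T = max (- (m\<^sub>n \<circ> T)) g\<close> would
  tend to \<open>g\<close> boundedly, while its integral is nonnegative by invariance of the measure and monotonicity in
  \<open>n\<close>. This would contradict that \<open>g\<close> has negative integral.
\<close>

lemma (in prob_space) ergodic_sums_bounded_below:
  fixes f :: "'a \<Rightarrow> real"
  assumes T: "ergodic M T" and [measurable]: "f \<in> borel_measurable M"
    and bound: "\<And>x. x \<in> space M \<Longrightarrow> \<bar>f x\<bar> \<le> B" and pos: "0 < expectation f"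
  shows "AE x in M. \<exists>C. \<forall>n. - C \<le> (\<Sum>k<n. f ((T ^^ k) x))"
proof -
  have [measurable]: "T \<in> M \<rightarrow>\<^sub>M M" and inv: "distr M M T = M"
    and erg: "\<And>A. A \<in> sets M \<Longrightarrow> T -` A \<inter> space M = A \<Longrightarrow> prob A = 0 \<or> prob A = 1"
    using T by (auto simp: ergodic_def)
  have Tspace: "T x \<in> space M" if "x \<in> space M" for x
    using that by (rule measurable_space[OF \<open>T \<in> M \<rightarrow>\<^sub>M M\<close>])
  define g where "g = (\<lambda>x. - f x)"
  have [measurable]: "g \<in> borel_measurable M" unfolding g_def by measurable
  define m where "m = max_sum T g"
  have m_Suc: "m (Suc n) x = max 0 (g x + m n (T x))" for n x
    by (simp add: m_def)
  have m_mono: "k \<le> n \<Longrightarrow> m k x \<le> m n x" for k n x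
    unfolding m_def by (rule max_sum_mono)
  have m_nonneg: "0 \<le> m n x" for n x
    unfolding m_def by (rule max_sum_nonneg)
  have [measurable]: "m n \<in> borel_measurable M" for n
  proof (induction n)
    case (Suc n)
    then show ?case unfolding m_Suc by measurable
  qed (simp add: m_def)
  have gB: "\<bar>g x\<bar> \<le> B" if "x \<in> space M" for x
    using bound[OF that] by (simp add: g_def)
  have m_le: "m n x \<le> real n * B" if "x \<in> space M" for n x
    using that
  proof (induction n arbitrary: x)
    case (Suc n)
    show ?case
      using Suc.IH[OF Tspace[OF Suc.prems]] gB[OF Suc.prems] by (simp add: m_Suc algebra_simps) 
  qed (simp add: m_def)
  have int_m: "integrable M (m n)" for n
    by (rule integrable_const_bound[of _ "real n * B"]) (use m_le m_nonneg in auto)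
  have int_g: "integrable M g"
    by (rule integrable_const_bound[of _ B]) (use gB in auto)
  define A where "A = {x \<in> space M. \<forall>N::nat. \<exists>n. real N < m n x}"
  have A [measurable]: "A \<in> sets M" unfolding A_def by measurable
  have "T -` A \<inter> space M = A"
  proof (intro set_eqI iffI)
    fix x assume x: "x \<in> T -` A \<inter> space M"
    have "\<exists>n. real N < m n x" for N
    proof -
      obtain n where "real (N + nat \<lceil>\<bar>g x\<bar>\<rceil>) < m n (T x)"
        using x unfolding A_def by blast
      then have "real N < m (Suc n) x"
        unfolding m_Suc using real_nat_ceiling_ge[of "\<bar>g x\<bar>"] by linarith
      then show ?thesis by blast
    qed
    with x show "x \<in> A" by (auto simp: A_def)
  next
    fix x assume x: "x \<in> A"
    have "\<exists>n. real N < m n (T x)" for N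
    proof -
      obtain n where n: "real (N + nat \<lceil>\<bar>g x\<bar>\<rceil>) < m n x"
        using x unfolding A_def by blast
      have "real N < m n (T x)"
      proof (cases n)
        case (Suc k)
        have "real N < m k (T x)"
          using n real_nat_ceiling_ge[of "\<bar>g x\<bar>"] unfolding Suc m_Suc by linarith
        with m_mono[of k n "T x"] Suc show ?thesis by simp
      next
        case 0
        then show ?thesis
          using n by (metis m_def max_sum.simps(1) not_less of_nat_0_le_iff)
      qed
      then show ?thesis by blast
    qed
    with x show "x \<in> T -` A \<inter> space M" by (auto simp: A_def Tspace)
  qed
  note invA = this
  have "prob A \<noteq> 1"
  proof
    assume "prob A = 1"
    then have AE_A: "AE x in M. x \<in> A" by (simp add: prob_eq_1)
    define d where "d = (\<lambda>n x. m (Suc n) x - m n (T x))"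
    have [measurable]: "d n \<in> borel_measurable M" for n
      unfolding d_def by measurable
    have d_nonneg: "0 \<le> expectation (d n)" for n
    proof -
      have "integrable (distr M M T) (m n)" using inv int_m by simp
      then have intT: "integrable M (\<lambda>x. m n (T x))" by (subst (asm) integrable_distr_eq) auto
      have "expectation (\<lambda>x. m n (T x)) = integral\<^sup>L (distr M M T) (m n)"
        by (subst integral_distr) auto
      also have "\<dots> = expectation (m n)" using inv by simp
      finally have "expectation (d n) = expectation (m (Suc n)) - expectation (m n)"
        unfolding d_def using intT int_m by simp
      also have "\<dots> \<ge> 0"
        using int_m m_mono by (simp add: integral_mono)
      finally show ?thesis .
    qed
    have "(\<lambda>n. expectation (d n)) \<longlonglongrightarrow> expectation g"
    proof (rule integral_dominated_convergence[where w = "\<lambda>_. B"])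
      show "AE x in M. (\<lambda>n. d n x) \<longlonglongrightarrow> g x"
        using AE_A
      proof eventually_elim
        case (elim x)
        then have "T x \<in> A" using invA by auto
        then obtain N where N: "real (nat \<lceil>\<bar>g x\<bar>\<rceil>) < m N (T x)" unfolding A_def by blast
        have "d n x = g x" if "N \<le> n" for n
          using N m_mono[OF that, of "T x"] real_nat_ceiling_ge[of "\<bar>g x\<bar>"]
          unfolding d_def m_Suc by linarith
        then show ?case
          by (intro tendsto_eventually) (auto simp: eventually_sequentially)
      qed
      show "AE x in M. norm (d n x) \<le> B" for n
      proof (rule AE_I2)
        fix x assume "x \<in> space M"
        then show "norm (d n x) \<le> B"
          using gB[of x] m_nonneg[of n "T x"] unfolding d_def m_Suc real_norm_def by linarith
      qed
    qed auto
    then have "0 \<le> expectation g"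
      using d_nonneg by (intro LIMSEQ_le_const) auto
    with pos show False by (simp add: g_def)
  qed
  with erg[OF A invA] have "prob A = 0" by blast
  then have "AE x in M. x \<notin> A"
    using A by (simp add: prob_eq_0)
  then show ?thesis
    using AE_space
  proof eventually_elim
    case (elim x)
    then obtain N where N: "\<And>n. m n x \<le> real N" by (auto simp: A_def not_less)
    have "- real N \<le> (\<Sum>k<n. f ((T ^^ k) x))" for n
      using order_trans[OF sum_le_max_sum[of g T x n, folded m_def] N[of n]]
      by (simp add: g_def sum_negf)
    then show ?case by blast
  qed
qed

text \<open>
  Boundedness from below, applied to \<open>\<plusminus> (f - E f) + 1 / (p + 1)\<close> for all \<open>p\<close>, confines the averages to every
  neighbourhood of the mean.
\<close>

lemma (in prob_space) birkhoff_bounded: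
  fixes f :: "'a \<Rightarrow> real"
  assumes T: "ergodic M T" and f [measurable]: "f \<in> borel_measurable M"
    and bound: "\<And>x. x \<in> space M \<Longrightarrow> \<bar>f x\<bar> \<le> B"
  shows "AE x in M. (\<lambda>n. (\<Sum>k<n. f ((T ^^ k) x)) / real n) \<longlonglongrightarrow> expectation f"
proof -
  have int_f: "integrable M f"
    by (rule integrable_const_bound[of _ B]) (use bound in auto)
  define e where "e = expectation f"
  define h where "h = (\<lambda>(s::real) p x. s * (f x - e) + 1 / Suc p)"
  have AE_h: "AE x in M. \<exists>C. \<forall>n. - C \<le> (\<Sum>k<n. h s p ((T ^^ k) x))" for s p
  proof (rule ergodic_sums_bounded_below[OF T])
    show "h s p \<in> borel_measurable M" unfolding h_def by measurable
    show "\<bar>h s p x\<bar> \<le> \<bar>s\<bar> * (B + \<bar>e\<bar>) + 1" if "x \<in> space M" for x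
    proof -
      have "\<bar>h s p x\<bar> \<le> \<bar>s * (f x - e)\<bar> + 1 / Suc p"
        unfolding h_def by (rule order_trans[OF abs_triangle_ineq]) simp
      also have "\<dots> \<le> \<bar>s\<bar> * (B + \<bar>e\<bar>) + 1"
        using bound[OF that] unfolding abs_mult by (intro add_mono mult_left_mono) auto
      finally show ?thesis .
    qed
    have "expectation (h s p) = 1 / Suc p"
      unfolding h_def using int_f by (simp add: e_def prob_space)
    then show "0 < expectation (h s p)" by simp
  qed
  have "AE x in M. \<forall>p. \<exists>C. \<forall>n. - C \<le> (\<Sum>k<n. h 1 p ((T ^^ k) x))"
    "AE x in M. \<forall>p. \<exists>C. \<forall>n. - C \<le> (\<Sum>k<n. h (- 1) p ((T ^^ k) x))"
    using AE_h by (simp_all add: AE_all_countable)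
  then show ?thesis
  proof eventually_elim
    case (elim x)
    let ?S = "\<lambda>n. \<Sum>k<n. f ((T ^^ k) x)"
    show ?case
    proof (rule LIMSEQ_I)
      fix \<epsilon> :: real assume "0 < \<epsilon>"
      obtain p where "inverse (real (Suc p)) < \<epsilon> / 2"
        using reals_Archimedean[of "\<epsilon> / 2"] \<open>0 < \<epsilon>\<close> by auto
      then have p: "1 / real (Suc p) < \<epsilon> / 2" by (simp add: inverse_eq_divide)
      obtain C1 C2 where C: "\<And>n. - C1 \<le> (\<Sum>k<n. h 1 p ((T ^^ k) x))"
          "\<And>n. - C2 \<le> (\<Sum>k<n. h (- 1) p ((T ^^ k) x))"
        using elim by metis
      have h1: "(\<Sum>k<n. h 1 p ((T ^^ k) x)) = ?S n - n * e + n * (1 / Suc p)"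
        and h2: "(\<Sum>k<n. h (- 1) p ((T ^^ k) x)) = n * e - ?S n + n * (1 / Suc p)" for n
        by (simp_all add: h_def sum.distrib sum_subtractf)
      define C where "C = \<bar>C1\<bar> + \<bar>C2\<bar>"
      have dev: "\<bar>?S n - n * e\<bar> \<le> C + n * (1 / Suc p)" for n
        using C(1)[of n, unfolded h1] C(2)[of n, unfolded h2] unfolding C_def by linarith
      obtain n0 where n0: "2 * C / \<epsilon> < real n0" using reals_Archimedean2 by blast
      show "\<exists>n0. \<forall>n\<ge>n0. norm (?S n / real n - expectation f) < \<epsilon>"
      proof (intro exI allI impI)
        fix n assume n: "Suc n0 \<le> n"
        then have "2 * C < \<epsilon> * n"
          using n0 \<open>0 < \<epsilon>\<close> by (simp add: divide_simps) (smt (verit) mult_left_mono of_nat_mono of_nat_Suc Suc_leD mult.commute)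
        moreover have "n * (1 / Suc p) \<le> n * (\<epsilon> / 2)"
          using p by (intro mult_left_mono) auto
        ultimately have "\<bar>?S n - n * e\<bar> < n * \<epsilon>"
        proof -
          have "n * (\<epsilon> / 2) = \<epsilon> * n / 2" "n * \<epsilon> = \<epsilon> * n" by simp_all
          with dev[of n] \<open>2 * C < \<epsilon> * n\<close> \<open>n * (1 / Suc p) \<le> n * (\<epsilon> / 2)\<close> show ?thesis
            by linarith
        qed
        moreover have "?S n / n - e = (?S n - n * e) / n"
          using n by (simp add: field_simps)
        ultimately show "norm (?S n / real n - expectation f) < \<epsilon>"
          using n by (simp add: e_def[symmetric] pos_divide_less_eq mult.commute)
      qed
    qed
  qed
qed

section \<open>Averages of the random rates\<close>

text \<open>
  The support is nonempty and lies in \<open>[0, \<infinity>)\<close>, so its infimum \<open>0\<close> is approached by points all of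
  whose neighbourhoods have positive measure.
\<close>

lemma left_endpoint_measure_pos:
  assumes \<nu>: "prob_space \<nu>" "sets \<nu> = sets borel" and pos: "AE x in \<nu>. 0 < x"
    and "left_endpoint \<nu> = 0" "0 < \<epsilon>"
  shows "0 < measure \<nu> {..\<epsilon>}"
proof -
  interpret \<nu>: prob_space \<nu> by fact
  have "0 \<le> x" if "x \<in> support \<nu>" for x
  proof (rule ccontr)
    assume "\<not> 0 \<le> x"
    then have "emeasure \<nu> {..<0} > 0"
      using that by (auto simp: support_def)
    moreover have "AE x in \<nu>. x \<notin> {..<0}"
      using pos by eventually_elim simp
    then have "emeasure \<nu> {..<0} = 0"
      using \<nu>(2) by (subst (asm) AE_iff_measurable[of "{..<0}"]) (auto simp: sets_eq_imp_space_eq[OF \<nu>(2)])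
    ultimately show False by simp
  qed
  then have "bdd_below (support \<nu>)" by (rule bdd_belowI)
  moreover have "Inf (support \<nu>) < \<epsilon>"
    using assms(4,5) by (simp add: left_endpoint_def)
  ultimately obtain x where x: "x \<in> support \<nu>" "x < \<epsilon>"
    using cInf_less_iff[OF support_nonempty[OF \<nu>]] by blast
  then have "0 < emeasure \<nu> {..<\<epsilon>}" by (auto simp: support_def)
  also have "\<dots> \<le> emeasure \<nu> {..\<epsilon>}"
    using \<nu>(2) by (intro emeasure_mono) auto
  finally show ?thesis
    by (simp add: \<nu>.emeasure_eq_measure)
qed

context exponential_model
begin

lemma space_joint: "space \<mu> = space (pos_seqs \<Otimes>\<^sub>M pos_seqs)"
  by (rule sets_eq_imp_space_eq[OF sets_joint_law])

lemma rates_pos: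
  assumes "ab \<in> space \<mu>" "1 \<le> i"
  shows "0 < fst ab i" "0 < snd ab i"
  using assms unfolding space_joint
  by (auto simp: space_pair_measure pos_seqs_def space_PiM PiE_def Pi_def space_restrict_space)

lemma measurable_rates:
  assumes "1 \<le> i"
  shows "(\<lambda>ab. fst ab i) \<in> borel_measurable \<mu>" "(\<lambda>ab. snd ab i) \<in> borel_measurable \<mu>"
proof -
  have "(\<lambda>c. c i) \<in> pos_seqs \<rightarrow>\<^sub>M restrict_space borel {0<..}"
    unfolding pos_seqs_def using assms by (intro measurable_component_singleton) simp
  then have *: "(\<lambda>c. c i) \<in> borel_measurable pos_seqs"
    by (simp add: measurable_restrict_space2_iff)
  show "(\<lambda>ab. fst ab i) \<in> borel_measurable \<mu>" "(\<lambda>ab. snd ab i) \<in> borel_measurable \<mu>"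
    using measurable_compose[OF measurable_fst *] measurable_compose[OF measurable_snd *]
    by (simp_all cong: measurable_cong_sets add: sets_joint_law)
qed

abbreviation joint_shift :: "(nat \<Rightarrow> real) \<times> (nat \<Rightarrow> real) \<Rightarrow> (nat \<Rightarrow> real) \<times> (nat \<Rightarrow> real)" where
  "joint_shift \<equiv> map_prod (shift 1) (shift 1)"

lemma joint_shift_funpow:
  assumes "1 \<le> i"
  shows "fst ((joint_shift ^^ k) ab) i = fst ab (i + k)" "snd ((joint_shift ^^ k) ab) i = snd ab (i + k)"
  using assms by (induction k arbitrary: i) (auto simp: shift_def)

lemma ergodic_joint_shift: "ergodic \<mu> joint_shift"
  by (rule totally_ergodic) auto

lemma nn_integral_joint_shift_funpow:
  assumes "f \<in> borel_measurable \<mu>"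
  shows "(\<integral>\<^sup>+ab. f ((joint_shift ^^ k) ab) \<partial>\<mu>) = (\<integral>\<^sup>+ab. f ab \<partial>\<mu>)"
  using assms
proof (induction k arbitrary: f)
  case (Suc k)
  have T: "joint_shift \<in> \<mu> \<rightarrow>\<^sub>M \<mu>" "distr \<mu> \<mu> joint_shift = \<mu>"
    using ergodic_joint_shift by (auto simp: ergodic_def)
  have "(\<integral>\<^sup>+ab. f ((joint_shift ^^ Suc k) ab) \<partial>\<mu>) = (\<integral>\<^sup>+ab. f (joint_shift ((joint_shift ^^ k) ab)) \<partial>\<mu>)"
    by simp
  also have "\<dots> = (\<integral>\<^sup>+ab. f (joint_shift ab) \<partial>\<mu>)"
    by (rule Suc.IH[OF measurable_compose[OF T(1) Suc.prems]])
  also have "\<dots> = (\<integral>\<^sup>+ab. f ab \<partial>distr \<mu> \<mu> joint_shift)"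
    using T(1) Suc.prems by (intro nn_integral_distr[symmetric]) simp_all
  finally show ?case by (simp only: T(2))
qed simp

lemma nn_integral_rates:
  assumes [measurable]: "h \<in> borel_measurable borel" and "1 \<le> i"
  shows "(\<integral>\<^sup>+ab. h (fst ab i) \<partial>\<mu>) = (\<integral>\<^sup>+ab. h (fst ab 1) \<partial>\<mu>)"
    and "(\<integral>\<^sup>+ab. h (snd ab i) \<partial>\<mu>) = (\<integral>\<^sup>+ab. h (snd ab 1) \<partial>\<mu>)"
proof -
  note [measurable] = measurable_rates[OF order_refl]
  show "(\<integral>\<^sup>+ab. h (fst ab i) \<partial>\<mu>) = (\<integral>\<^sup>+ab. h (fst ab 1) \<partial>\<mu>)"
    using nn_integral_joint_shift_funpow[OF measurable_compose[OF measurable_rates(1)[OF order_refl] assms(1)], of "i - 1"] assms(2)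
    unfolding joint_shift_funpow[OF order_refl] by simp
  show "(\<integral>\<^sup>+ab. h (snd ab i) \<partial>\<mu>) = (\<integral>\<^sup>+ab. h (snd ab 1) \<partial>\<mu>)"
    using nn_integral_joint_shift_funpow[OF measurable_compose[OF measurable_rates(2)[OF order_refl] assms(1)], of "i - 1"] assms(2)
    unfolding joint_shift_funpow[OF order_refl] by simp
qed

lemma averages_converge:
  fixes h :: "real \<Rightarrow> real"
  assumes [measurable]: "h \<in> borel_measurable borel" and bound: "\<And>x. 0 < x \<Longrightarrow> \<bar>h x\<bar> \<le> B"
  shows "AE ab in \<mu>. (\<lambda>n. (\<Sum>i=1..n. h (fst ab i)) / real n) \<longlonglongrightarrow> expectation (\<lambda>ab. h (fst ab 1))"
    and "AE ab in \<mu>. (\<lambda>n. (\<Sum>j=1..n. h (snd ab j)) / real n) \<longlonglongrightarrow> expectation (\<lambda>ab. h (snd ab 1))"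
proof -
  note [measurable] = measurable_rates[OF order_refl]
  have reindex: "(\<Sum>k<n. h (c (1 + k))) = (\<Sum>i=1..n. h (c i))" for n and c :: "nat \<Rightarrow> real"
    by (rule sum.reindex_bij_witness[of _ "\<lambda>i. i - 1" "\<lambda>k. 1 + k"]) auto
  have "AE ab in \<mu>. (\<lambda>n. (\<Sum>k<n. h (fst ((joint_shift ^^ k) ab) 1)) / real n) \<longlonglongrightarrow> expectation (\<lambda>ab. h (fst ab 1))"
    using bound[OF rates_pos(1)[OF _ order_refl]]
    by (intro birkhoff_bounded[OF ergodic_joint_shift, where f = "\<lambda>ab. h (fst ab 1)"]) measurable
  then show "AE ab in \<mu>. (\<lambda>n. (\<Sum>i=1..n. h (fst ab i)) / real n) \<longlonglongrightarrow> expectation (\<lambda>ab. h (fst ab 1))"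
    unfolding joint_shift_funpow[OF order_refl] reindex .
  have "AE ab in \<mu>. (\<lambda>n. (\<Sum>k<n. h (snd ((joint_shift ^^ k) ab) 1)) / real n) \<longlonglongrightarrow> expectation (\<lambda>ab. h (snd ab 1))"
    using bound[OF rates_pos(2)[OF _ order_refl]]
    by (intro birkhoff_bounded[OF ergodic_joint_shift, where f = "\<lambda>ab. h (snd ab 1)"]) measurable
  then show "AE ab in \<mu>. (\<lambda>n. (\<Sum>j=1..n. h (snd ab j)) / real n) \<longlonglongrightarrow> expectation (\<lambda>ab. h (snd ab 1))"
    unfolding joint_shift_funpow[OF order_refl] reindex .
qed

lemma small_rate_prob_pos:
  assumes "0 < \<epsilon>"
  shows "left_endpoint (law_a \<mu>) = 0 \<Longrightarrow> 0 < expectation (\<lambda>ab. if fst ab 1 \<le> \<epsilon> then 1 else 0 :: real)"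
    and "left_endpoint (law_b \<mu>) = 0 \<Longrightarrow> 0 < expectation (\<lambda>ab. if snd ab 1 \<le> \<epsilon> then 1 else 0 :: real)"
proof -
  have *: "0 < expectation (\<lambda>ab. if X ab \<le> \<epsilon> then 1 else 0 :: real)"
    if X [measurable]: "X \<in> borel_measurable \<mu>" and pos: "\<And>ab. ab \<in> space \<mu> \<Longrightarrow> 0 < X ab"
      and "left_endpoint (distr \<mu> borel X) = 0" for X
  proof -
    have "0 < measure (distr \<mu> borel X) {..\<epsilon>}"
      using that assms by (intro left_endpoint_measure_pos prob_space_distr) (auto simp: AE_distr_iff)
    also have "\<dots> = prob {ab \<in> space \<mu>. X ab \<le> \<epsilon>}"
      by (subst measure_distr) (auto intro!: arg_cong[where f = prob])
    also have "\<dots> = expectation (indicator {ab \<in> space \<mu>. X ab \<le> \<epsilon>})"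
      by simp
    also have "\<dots> = expectation (\<lambda>ab. if X ab \<le> \<epsilon> then 1 else 0 :: real)"
      by (intro Bochner_Integration.integral_cong) (auto simp: indicator_def)
    finally show ?thesis .
  qed
  show "left_endpoint (law_a \<mu>) = 0 \<Longrightarrow> 0 < expectation (\<lambda>ab. if fst ab 1 \<le> \<epsilon> then 1 else 0 :: real)"
    by (rule *) (auto simp: law_a_def split_beta' intro: measurable_rates rates_pos)
  show "left_endpoint (law_b \<mu>) = 0 \<Longrightarrow> 0 < expectation (\<lambda>ab. if snd ab 1 \<le> \<epsilon> then 1 else 0 :: real)"
    by (rule *) (auto simp: law_b_def split_beta' intro: measurable_rates rates_pos)
qed

end

section \<open>The shape function\<close>

definition scaled_passage :: "real \<Rightarrow> real \<Rightarrow> nat \<Rightarrow> (nat \<times> nat \<Rightarrow> real) \<Rightarrow> ennreal" where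
  "scaled_passage s t n W = ennreal (last_passage W (nat \<lfloor>real n * s\<rfloor>) (nat \<lfloor>real n * t\<rfloor>) / real n)"

lemma measurable_last_passage_borel:
  assumes "1 \<le> m" "1 \<le> n"
  shows "(\<lambda>W. last_passage W m n) \<in> borel_measurable (\<Pi>\<^sub>M z\<in>{1..} \<times> {1..}. borel)"
proof -
  have sub: "{1..m} \<times> {1..n} \<subseteq> {1..} \<times> {1..}" by auto
  have "sets (\<Pi>\<^sub>M z\<in>{1..} \<times> {1..}. exp_law (1::real)) = sets (\<Pi>\<^sub>M z\<in>{1..} \<times> {1..}. borel)"
    by (intro sets_PiM_cong) auto
  from measurable_cong_sets[OF this refl] show ?thesis
    using measurable_last_passage[OF sub assms, of "\<lambda>_. 1"] by simp
qed

lemma measurable_scaled_passage: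
  assumes "1 \<le> nat \<lfloor>real n * s\<rfloor>" "1 \<le> nat \<lfloor>real n * t\<rfloor>"
  shows "scaled_passage s t n \<in> borel_measurable (\<Pi>\<^sub>M z\<in>{1..} \<times> {1..}. borel)"
  unfolding scaled_passage_def using assms
  by (intro measurable_compose[OF _ measurable_ennreal] borel_measurable_divide
      measurable_last_passage_borel borel_measurable_const)

lemma liminf_scaled_passage_shift:
  "liminf (\<lambda>n. scaled_passage s t (n + k) W) = liminf (\<lambda>n. scaled_passage s t n W)"
  by (rule liminf_shift_k[of "\<lambda>n. scaled_passage s t n W"])

context exponential_model
begin

lemma quenched_measurable:
  "quenched_law \<in> \<mu> \<rightarrow>\<^sub>M subprob_algebra (\<Pi>\<^sub>M z\<in>{1..} \<times> {1..}. borel)"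
  using measurable_prob_algebraD[OF measurable_quenched_law] sets_joint_law
  by (simp cong: measurable_cong_sets)

lemma prob_space_quenched:
  assumes "ab \<in> space \<mu>"
  shows "prob_space (quenched_law ab)"
  using measurable_space[OF measurable_quenched_law] assms
  by (auto simp: space_joint space_prob_algebra)

text \<open>
  For small \<open>n\<close> the box may be empty and the last-passage time has no meaning, so measurability is
  available only from some \<open>n\<close> on. Passing to the lower limit for fixed \<open>s\<close> and \<open>t\<close> gives a measurable
  event, so that the annealed statement transfers to the quenched laws.
\<close>

lemma shape_liminf:
  assumes g: "is_shape_function \<mu> g" and st: "0 < s" "0 < t"
  shows "AE ab in \<mu>. AE W in quenched_law ab. liminf (\<lambda>n. scaled_passage s t n W) = g s t"
proof -
  have "\<forall>\<^sub>F n in sequentially. 1 \<le> nat \<lfloor>real n * s\<rfloor> \<and> 1 \<le> nat \<lfloor>real n * t\<rfloor>"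
    using filterlim_nat_floor_mult[OF st(1), unfolded filterlim_at_top, rule_format, of 1]
      filterlim_nat_floor_mult[OF st(2), unfolded filterlim_at_top, rule_format, of 1]
    by eventually_elim blast
  then obtain n0 where n0: "\<And>n. n0 \<le> n \<Longrightarrow> 1 \<le> nat \<lfloor>real n * s\<rfloor> \<and> 1 \<le> nat \<lfloor>real n * t\<rfloor>"
    by (auto simp: eventually_sequentially)
  have lim: "AE W in annealed_law \<mu>. liminf (\<lambda>n. scaled_passage s t (n + n0) W) = g s t"
    using g unfolding is_shape_function_def
  proof eventually_elim
    case (elim W)
    then have "(\<lambda>n. scaled_passage s t n W) \<longlonglongrightarrow> g s t"
      using st unfolding scaled_passage_def by blast
    then have "(\<lambda>n. scaled_passage s t (n + n0) W) \<longlonglongrightarrow> g s t"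
      by (rule LIMSEQ_ignore_initial_segment)
    then show ?case by (intro lim_imp_Liminf) simp_all
  qed
  have [measurable]: "scaled_passage s t (n + n0) \<in> borel_measurable (\<Pi>\<^sub>M z\<in>{1..} \<times> {1..}. borel)" for n
    using n0[of "n + n0"] by (intro measurable_scaled_passage) auto
  have "(\<lambda>W. liminf (\<lambda>n. scaled_passage s t (n + n0) W))
      \<in> borel_measurable (\<Pi>\<^sub>M z\<in>{1..} \<times> {1..}. borel)"
    by measurable
  from measurable_sets[OF this, of "{g s t}"]
  have pred: "Measurable.pred (\<Pi>\<^sub>M z\<in>{1..} \<times> {1..}. borel)
      (\<lambda>W. liminf (\<lambda>n. scaled_passage s t (n + n0) W) = g s t)"
    by (simp add: pred_def vimage_def Int_def conj_commute)
  from lim show ?thesis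
    unfolding annealed_law_def AE_bind[OF quenched_measurable pred]
    unfolding liminf_scaled_passage_shift .
qed

text \<open>
  Fatou's lemma under the annealed law; by stationarity the averaged mean of \<open>G(m, n)\<close> is at most
  \<open>m E[1/a] + n E[1/b]\<close>.
\<close>

lemma shape_upper_bound:
  assumes g: "is_shape_function \<mu> g" and st: "0 < s" "0 < t"
  shows "g s t \<le> ennreal s * (\<integral>\<^sup>+ab. ennreal (1 / fst ab 1) \<partial>\<mu>)
    + ennreal t * (\<integral>\<^sup>+ab. ennreal (1 / snd ab 1) \<partial>\<mu>)" (is "_ \<le> ?R")
proof -
  have box: "\<forall>\<^sub>F n in sequentially. 1 \<le> nat \<lfloor>real n * s\<rfloor> \<and> 1 \<le> nat \<lfloor>real n * t\<rfloor> \<and> 0 < n"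
    using filterlim_nat_floor_mult[OF st(1), unfolded filterlim_at_top, rule_format, of 1]
      filterlim_nat_floor_mult[OF st(2), unfolded filterlim_at_top, rule_format, of 1]
      eventually_gt_at_top[of 0]
    by eventually_elim blast
  then obtain n0 where n0: "\<And>n. n0 \<le> n \<Longrightarrow> 1 \<le> nat \<lfloor>real n * s\<rfloor> \<and> 1 \<le> nat \<lfloor>real n * t\<rfloor> \<and> 0 < n"
    by (auto simp: eventually_sequentially)
  let ?B = "\<Pi>\<^sub>M z\<in>{1::nat..} \<times> {1::nat..}. (borel :: real measure)"
  have meas [measurable]: "scaled_passage s t (n + n0) \<in> borel_measurable ?B" for n
    using n0[of "n + n0"] by (intro measurable_scaled_passage) auto
  have mean: "(\<integral>\<^sup>+ab. \<integral>\<^sup>+W. scaled_passage s t (n + n0) W \<partial>quenched_law ab \<partial>\<mu>) \<le> ?R" for n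
  proof -
    define k where "k = n + n0"
    let ?m = "nat \<lfloor>real k * s\<rfloor>" and ?n = "nat \<lfloor>real k * t\<rfloor>"
    have k: "1 \<le> ?m" "1 \<le> ?n" "0 < k" using n0[of k] by (auto simp: k_def)
    note [measurable] = measurable_rates
    have "(\<integral>\<^sup>+ab. \<integral>\<^sup>+W. scaled_passage s t k W \<partial>quenched_law ab \<partial>\<mu>)
      \<le> (\<integral>\<^sup>+ab. ennreal (1 / k) * ((\<Sum>i=1..?m. ennreal (1 / fst ab i)) + (\<Sum>j=1..?n. ennreal (1 / snd ab j))) \<partial>\<mu>)"
    proof (rule nn_integral_mono)
      fix ab assume ab: "ab \<in> space \<mu>"
      have "(\<lambda>W. ennreal (last_passage W ?m ?n)) \<in> borel_measurable ?B"
        using k by (intro measurable_compose[OF measurable_last_passage_borel measurable_ennreal])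
      then have m: "(\<lambda>W. ennreal (last_passage W ?m ?n)) \<in> borel_measurable (quenched_law ab)"
        by (subst measurable_cong_sets[OF sets_quenched_law refl])
      have "(\<integral>\<^sup>+W. scaled_passage s t k W \<partial>quenched_law ab)
          = (\<integral>\<^sup>+W. ennreal (1 / k) * ennreal (last_passage W ?m ?n) \<partial>quenched_law ab)"
        unfolding scaled_passage_def by (intro nn_integral_cong) (simp add: ennreal_mult'[symmetric])
      also have "\<dots> = ennreal (1 / k) * (\<integral>\<^sup>+W. ennreal (last_passage W ?m ?n) \<partial>quenched_law ab)"
        by (rule nn_integral_cmult[OF m])
      also have "\<dots> \<le> ennreal (1 / k) * ((\<Sum>i=1..?m. ennreal (1 / fst ab i)) + (\<Sum>j=1..?n. ennreal (1 / snd ab j)))"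
        using nn_integral_last_passage_le[OF k(1,2), of "fst ab" "snd ab"] rates_pos[OF ab]
        by (intro mult_left_mono) auto
      finally show "(\<integral>\<^sup>+W. scaled_passage s t k W \<partial>quenched_law ab)
        \<le> ennreal (1 / k) * ((\<Sum>i=1..?m. ennreal (1 / fst ab i)) + (\<Sum>j=1..?n. ennreal (1 / snd ab j)))" .
    qed
    also have "\<dots> = ennreal (1 / k) * ((\<Sum>i=1..?m. \<integral>\<^sup>+ab. ennreal (1 / fst ab i) \<partial>\<mu>)
        + (\<Sum>j=1..?n. \<integral>\<^sup>+ab. ennreal (1 / snd ab j) \<partial>\<mu>))"
    proof -
      have 1: "(\<lambda>ab. ennreal (1 / fst ab i)) \<in> borel_measurable \<mu>" if "i \<in> {1..?m}" for i
        using measurable_rates(1)[of i] that by simp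
      have 2: "(\<lambda>ab. ennreal (1 / snd ab i)) \<in> borel_measurable \<mu>" if "i \<in> {1..?n}" for i
        using measurable_rates(2)[of i] that by simp
      show ?thesis
        by (subst nn_integral_cmult, (intro borel_measurable_add borel_measurable_sum 1 2; assumption)+,
            subst nn_integral_add, (intro borel_measurable_sum 1 2; assumption)+)
          (simp only: nn_integral_sum 1 2)
    qed
    also have "(\<Sum>i=1..?m. \<integral>\<^sup>+ab. ennreal (1 / fst ab i) \<partial>\<mu>)
        = (\<Sum>i=1..?m. \<integral>\<^sup>+ab. ennreal (1 / fst ab 1) \<partial>\<mu>)"
      by (intro sum.cong refl nn_integral_rates(1)[where h = "\<lambda>x. ennreal (1 / x)"]) auto
    also have "\<dots> = of_nat ?m * (\<integral>\<^sup>+ab. ennreal (1 / fst ab 1) \<partial>\<mu>)"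
      by simp
    also have "(\<Sum>j=1..?n. \<integral>\<^sup>+ab. ennreal (1 / snd ab j) \<partial>\<mu>)
        = (\<Sum>j=1..?n. \<integral>\<^sup>+ab. ennreal (1 / snd ab 1) \<partial>\<mu>)"
      by (intro sum.cong refl nn_integral_rates(2)[where h = "\<lambda>x. ennreal (1 / x)"]) auto
    also have "\<dots> = of_nat ?n * (\<integral>\<^sup>+ab. ennreal (1 / snd ab 1) \<partial>\<mu>)"
      by simp
    also have "ennreal (1 / k) * (of_nat ?m * (\<integral>\<^sup>+ab. ennreal (1 / fst ab 1) \<partial>\<mu>) + of_nat ?n * (\<integral>\<^sup>+ab. ennreal (1 / snd ab 1) \<partial>\<mu>))
        = ennreal (?m / k) * (\<integral>\<^sup>+ab. ennreal (1 / fst ab 1) \<partial>\<mu>) + ennreal (?n / k) * (\<integral>\<^sup>+ab. ennreal (1 / snd ab 1) \<partial>\<mu>)"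
      by (simp add: distrib_left mult.assoc[symmetric] ennreal_of_nat_eq_real_of_nat ennreal_mult[symmetric])
    also have "\<dots> \<le> ?R"
    proof (intro add_mono mult_right_mono ennreal_leI)
      have "real ?m \<le> k * s" "real ?n \<le> k * t" using st by simp_all
      then show "?m / k \<le> s" "?n / k \<le> t" using k by (simp_all add: pos_divide_le_eq mult.commute)
    qed simp_all
    finally show ?thesis by (simp add: k_def)
  qed
  have "g s t = (\<integral>\<^sup>+ab. g s t \<partial>\<mu>)"
    by (simp add: emeasure_space_1)
  also have "\<dots> = (\<integral>\<^sup>+ab. \<integral>\<^sup>+W. liminf (\<lambda>n. scaled_passage s t (n + n0) W) \<partial>quenched_law ab \<partial>\<mu>)"
  proof (rule nn_integral_cong_AE)
    have "AE ab in \<mu>. AE W in quenched_law ab. liminf (\<lambda>n. scaled_passage s t (n + n0) W) = g s t"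
      unfolding liminf_scaled_passage_shift by (rule shape_liminf[OF g st])
    then show "AE ab in \<mu>. g s t = (\<integral>\<^sup>+W. liminf (\<lambda>n. scaled_passage s t (n + n0) W) \<partial>quenched_law ab)"
      using AE_space
    proof eventually_elim
      case (elim ab)
      then interpret Q: prob_space "quenched_law ab" by (intro prob_space_quenched)
      have "(\<integral>\<^sup>+W. liminf (\<lambda>n. scaled_passage s t (n + n0) W) \<partial>quenched_law ab) = (\<integral>\<^sup>+W. g s t \<partial>quenched_law ab)"
        using elim(1) by (intro nn_integral_cong_AE)
      then show ?case by (simp add: Q.emeasure_space_1)
    qed
  qed
  also have "\<dots> = (\<integral>\<^sup>+W. liminf (\<lambda>n. scaled_passage s t (n + n0) W) \<partial>annealed_law \<mu>)"
    unfolding annealed_law_def by (intro nn_integral_bind[OF _ quenched_measurable, symmetric]) measurable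
  also have "\<dots> \<le> liminf (\<lambda>n. \<integral>\<^sup>+W. scaled_passage s t (n + n0) W \<partial>annealed_law \<mu>)"
  proof (rule nn_integral_liminf)
    have "sets (annealed_law \<mu>) = sets ?B"
      unfolding annealed_law_def
      by (rule sets_bind[OF sets_kernel[OF quenched_measurable] not_empty])
    then show "scaled_passage s t (n + n0) \<in> borel_measurable (annealed_law \<mu>)" for n
      using meas by (simp cong: measurable_cong_sets)
  qed
  also have "\<dots> = liminf (\<lambda>n. \<integral>\<^sup>+ab. \<integral>\<^sup>+W. scaled_passage s t (n + n0) W \<partial>quenched_law ab \<partial>\<mu>)"
    unfolding annealed_law_def by (subst nn_integral_bind[OF meas quenched_measurable]) simp
  also have "\<dots> \<le> liminf (\<lambda>n::nat. ?R)"
    by (intro Liminf_mono always_eventually allI mean)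
  also have "\<dots> = ?R"
    by (simp add: Liminf_const)
  finally show ?thesis .
qed

text \<open>
  The shape function is the same constant for almost every choice of the rates, so one typical choice decides.
\<close>

lemma shape_lower_bound_regularized:
  assumes g: "is_shape_function \<mu> g" and st: "0 < s" "0 < t" and \<epsilon>: "0 < \<epsilon>"
    and la: "left_endpoint (law_a \<mu>) = 0" and lb: "left_endpoint (law_b \<mu>) = 0"
  shows "ennreal s * (\<integral>\<^sup>+ab. ennreal (1 / (fst ab 1 + \<epsilon>)) \<partial>\<mu>)
    + ennreal t * (\<integral>\<^sup>+ab. ennreal (1 / (snd ab 1 + \<epsilon>)) \<partial>\<mu>) \<le> g s t"
proof -
  define A where "A = expectation (\<lambda>ab. 1 / (fst ab 1 + \<epsilon>))"
  define B where "B = expectation (\<lambda>ab. 1 / (snd ab 1 + \<epsilon>))"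
  note [measurable] = measurable_rates[OF order_refl]
  have bound: "\<bar>1 / (x + \<epsilon>)\<bar> \<le> 1 / \<epsilon>" if "0 < x" for x
    using \<epsilon> that by (simp add: frac_le)
  have int: "integrable \<mu> (\<lambda>ab. 1 / (fst ab 1 + \<epsilon>))" "integrable \<mu> (\<lambda>ab. 1 / (snd ab 1 + \<epsilon>))"
    using bound rates_pos[OF _ order_refl]
    by (auto intro!: integrable_const_bound[where B = "1 / \<epsilon>"] AE_I2 simp del: One_nat_def)
  have nonneg: "0 \<le> 1 / (fst ab 1 + \<epsilon>)" "0 \<le> 1 / (snd ab 1 + \<epsilon>)" if "ab \<in> space \<mu>" for ab
    using rates_pos[OF that order_refl] \<epsilon> by simp_all
  have AB: "0 \<le> A" "0 \<le> B"
    unfolding A_def B_def using nonneg by (auto intro!: integral_nonneg_AE AE_I2 simp del: One_nat_def)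
  have below: "ennreal c \<le> g s t" if c: "c < s * A + t * B" for c
  proof -
    \<comment> \<open>Close enough to \<open>s\<close> to keep the bound above \<open>c\<close>; the added \<open>1\<close> avoids dividing by zero if \<open>A = 0\<close>.\<close>
    define u where "u = max (s / 2) (s - (s * A + t * B - c) / (2 * (A + 1)))"
    have u: "0 < u" "u < s"
      using st c AB by (auto simp: u_def)
    have "(s - (s * A + t * B - c) / (2 * (A + 1))) * A \<le> u * A"
      using AB by (intro mult_right_mono) (simp_all add: u_def)
    moreover have "(s * A + t * B - c) / (2 * (A + 1)) * A < s * A + t * B - c"
    proof -
      have "(s * A + t * B - c) / (2 * (A + 1)) * A = (s * A + t * B - c) * (A / (2 * (A + 1)))" by simp
      also have "\<dots> < (s * A + t * B - c) * 1"
        using c AB by (intro mult_strict_left_mono) (auto simp: divide_simps)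
      finally show ?thesis by simp
    qed
    ultimately have cu: "c < u * A + t * B" by (simp add: left_diff_distrib)
    define p where "p = expectation (\<lambda>ab. if fst ab 1 \<le> \<epsilon> then 1 else 0 :: real)"
    define q where "q = expectation (\<lambda>ab. if snd ab 1 \<le> \<epsilon> then 1 else 0 :: real)"
    have pq: "0 < p" "0 < q"
      unfolding p_def q_def using small_rate_prob_pos[OF \<epsilon>] la lb by auto
    have "AE ab in \<mu>. (\<lambda>n. (\<Sum>i=1..n. 1 / (fst ab i + \<epsilon>)) / real n) \<longlonglongrightarrow> A"
        "AE ab in \<mu>. (\<lambda>n. (\<Sum>j=1..n. 1 / (snd ab j + \<epsilon>)) / real n) \<longlonglongrightarrow> B"
      unfolding A_def B_def using averages_converge[of "\<lambda>x. 1 / (x + \<epsilon>)", OF _ bound] by simp_all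
    moreover have "AE ab in \<mu>. (\<lambda>n. (\<Sum>i=1..n. if fst ab i \<le> \<epsilon> then 1 else 0) / real n) \<longlonglongrightarrow> p"
        "AE ab in \<mu>. (\<lambda>n. (\<Sum>j=1..n. if snd ab j \<le> \<epsilon> then 1 else 0) / real n) \<longlonglongrightarrow> q"
      unfolding p_def q_def using averages_converge[of "\<lambda>x. if x \<le> \<epsilon> then 1 else 0" 1] by simp_all
    moreover have "AE ab in \<mu>. AE W in quenched_law ab. liminf (\<lambda>n. scaled_passage s t n W) = g s t"
      using shape_liminf[OF g st] .
    ultimately have "AE ab in \<mu>. ennreal c \<le> g s t"
      using AE_space
    proof eventually_elim
      case (elim ab)
      interpret Q: prob_space "quenched_law ab" by (rule prob_space_quenched) fact
      have "\<exists>j. 1 \<le> j \<and> snd ab j \<le> \<epsilon>"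
      proof (rule ccontr)
        assume "\<not> ?thesis"
        then have "(\<Sum>j=1..n. if snd ab j \<le> \<epsilon> then 1 else 0 :: real) = 0" for n
          by (intro sum.neutral) auto
        then have "(\<lambda>n::nat. 0) \<longlonglongrightarrow> q" using elim(4) by simp
        then show False using pq LIMSEQ_unique tendsto_const by blast
      qed
      then obtain j where j: "1 \<le> j" "snd ab j \<le> \<epsilon>" by blast
      have "AE W in quenched_law (fst ab, snd ab). \<forall>\<^sub>F n in sequentially.
          c \<le> last_passage W (nat \<lfloor>real n * s\<rfloor>) (nat \<lfloor>real n * t\<rfloor>) / real n"
        using rates_pos[OF elim(6)] elim(1-3) pq(1) j u st(2) cu \<epsilon>
        by (intro quenched_lower_bound[where \<epsilon> = \<epsilon> and A = A and B = B and p = p and j = j and u = u])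
      then have "AE W in quenched_law ab. \<forall>\<^sub>F n in sequentially.
          c \<le> last_passage W (nat \<lfloor>real n * s\<rfloor>) (nat \<lfloor>real n * t\<rfloor>) / real n"
        unfolding prod.collapse .
      then have "AE W in quenched_law ab. ennreal c \<le> g s t"
        using elim(5)
      proof eventually_elim
        case (elim W)
        have "ennreal c \<le> liminf (\<lambda>n. scaled_passage s t n W)"
          using elim(1) by (intro Liminf_bounded) (auto elim!: eventually_mono simp: scaled_passage_def intro: ennreal_leI)
        with elim(2) show ?case by simp
      qed
      then show ?case by simp
    qed
    then show ?thesis by simp
  qed
  have "ennreal (s * A + t * B) \<le> g s t"
  proof (rule LIMSEQ_le_const2)
    have "(\<lambda>n. s * A + t * B - 1 / real (Suc n)) \<longlonglongrightarrow> s * A + t * B - 0"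
      by (intro tendsto_diff tendsto_const LIMSEQ_Suc[OF lim_1_over_n])
    then show "(\<lambda>n. ennreal (s * A + t * B - 1 / real (Suc n))) \<longlonglongrightarrow> ennreal (s * A + t * B)"
      by (intro tendsto_ennrealI) simp
    show "\<exists>n0. \<forall>n\<ge>n0. ennreal (s * A + t * B - 1 / real (Suc n)) \<le> g s t"
      by (intro exI[of _ 0] allI impI below) simp
  qed
  moreover have "(\<integral>\<^sup>+ab. ennreal (1 / (fst ab 1 + \<epsilon>)) \<partial>\<mu>) = ennreal A"
      "(\<integral>\<^sup>+ab. ennreal (1 / (snd ab 1 + \<epsilon>)) \<partial>\<mu>) = ennreal B"
    unfolding A_def B_def using int nonneg by (auto intro!: nn_integral_eq_integral AE_I2 simp del: One_nat_def)
  ultimately show ?thesis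
    using st AB by (simp add: ennreal_mult)
qed

text \<open>
  Fatou's lemma in \<open>\<epsilon>\<close>, where the expectations may be infinite.
\<close>

lemma shape_lower_bound:
  assumes g: "is_shape_function \<mu> g" and st: "0 < s" "0 < t"
    and la: "left_endpoint (law_a \<mu>) = 0" and lb: "left_endpoint (law_b \<mu>) = 0"
  shows "ennreal s * (\<integral>\<^sup>+ab. ennreal (1 / fst ab 1) \<partial>\<mu>)
    + ennreal t * (\<integral>\<^sup>+ab. ennreal (1 / snd ab 1) \<partial>\<mu>) \<le> g s t"
proof -
  note [measurable] = measurable_rates[OF order_refl]
  define \<epsilon> where "\<epsilon> = (\<lambda>n. 1 / real (Suc n))"
  have \<epsilon>: "0 < \<epsilon> n" for n by (simp add: \<epsilon>_def)
  have \<epsilon>_lim: "\<epsilon> \<longlonglongrightarrow> 0"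
    unfolding \<epsilon>_def by (rule LIMSEQ_Suc[OF lim_1_over_n])
  have lim: "(\<lambda>n. ennreal (1 / (x + \<epsilon> n))) \<longlonglongrightarrow> ennreal (1 / x)" if "0 < x" for x
    using that tendsto_divide[OF tendsto_const tendsto_add[OF tendsto_const \<epsilon>_lim], of x 1]
    by (intro tendsto_ennrealI) simp
  define f :: "real \<Rightarrow> (nat \<Rightarrow> real) \<times> (nat \<Rightarrow> real) \<Rightarrow> ennreal"
    where "f = (\<lambda>e ab. ennreal s * ennreal (1 / (fst ab 1 + e)) + ennreal t * ennreal (1 / (snd ab 1 + e)))"
  have f_meas [measurable]: "f e \<in> borel_measurable \<mu>" for e
    unfolding f_def by measurable
  have f_int: "(\<integral>\<^sup>+ab. f e ab \<partial>\<mu>) = ennreal s * (\<integral>\<^sup>+ab. ennreal (1 / (fst ab 1 + e)) \<partial>\<mu>)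
      + ennreal t * (\<integral>\<^sup>+ab. ennreal (1 / (snd ab 1 + e)) \<partial>\<mu>)" for e
  proof -
    have m1: "(\<lambda>ab. ennreal (1 / (fst ab 1 + e))) \<in> borel_measurable \<mu>"
      and m2: "(\<lambda>ab. ennreal (1 / (snd ab 1 + e))) \<in> borel_measurable \<mu>"
      by measurable
    then show ?thesis
      unfolding f_def nn_integral_cmult[OF m1, symmetric] nn_integral_cmult[OF m2, symmetric]
      by (intro nn_integral_add) measurable
  qed
  have "ennreal s * (\<integral>\<^sup>+ab. ennreal (1 / fst ab 1) \<partial>\<mu>) + ennreal t * (\<integral>\<^sup>+ab. ennreal (1 / snd ab 1) \<partial>\<mu>)
      = (\<integral>\<^sup>+ab. f 0 ab \<partial>\<mu>)"
    by (simp add: f_int)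
  also have "\<dots> = (\<integral>\<^sup>+ab. liminf (\<lambda>n. f (\<epsilon> n) ab) \<partial>\<mu>)"
  proof (rule nn_integral_cong)
    fix ab assume "ab \<in> space \<mu>"
    then have "(\<lambda>n. f (\<epsilon> n) ab) \<longlonglongrightarrow> f 0 ab"
      unfolding f_def add_0_right using rates_pos[of ab 1]
      by (intro tendsto_add ennreal_tendsto_cmult lim) auto
    then show "f 0 ab = liminf (\<lambda>n. f (\<epsilon> n) ab)"
      by (intro lim_imp_Liminf[symmetric]) simp_all
  qed
  also have "\<dots> \<le> liminf (\<lambda>n. \<integral>\<^sup>+ab. f (\<epsilon> n) ab \<partial>\<mu>)"
    by (rule nn_integral_liminf) measurable
  also have "\<dots> \<le> liminf (\<lambda>n::nat. g s t)"
    unfolding f_int using shape_lower_bound_regularized[OF g st \<epsilon> la lb]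
    by (intro Liminf_mono always_eventually allI)
  also have "\<dots> = g s t"
    by (simp add: Liminf_const)
  finally show ?thesis .
qed

end

theorem mainTheorem2:
  fixes \<mu> :: "((nat \<Rightarrow> real) \<times> (nat \<Rightarrow> real)) measure"
    and g :: "real \<Rightarrow> real \<Rightarrow> ennreal"
  assumes "exponential_model \<mu>"
    and "is_shape_function \<mu> g"
    and "left_endpoint (law_a \<mu>) = 0"
    and "left_endpoint (law_b \<mu>) = 0"
  shows "\<forall>s>0. \<forall>t>0. g s t =
    ennreal s * (\<integral>\<^sup>+(a, b). ennreal (1 / a 1) \<partial>\<mu>) +
    ennreal t * (\<integral>\<^sup>+(a, b). ennreal (1 / b 1) \<partial>\<mu>)"
proof (intro allI impI)
  fix s t :: real assume st: "0 < s" "0 < t"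
  interpret exponential_model \<mu> by fact
  show "g s t = ennreal s * (\<integral>\<^sup>+(a, b). ennreal (1 / a 1) \<partial>\<mu>)
      + ennreal t * (\<integral>\<^sup>+(a, b). ennreal (1 / b 1) \<partial>\<mu>)"
    unfolding case_prod_beta'
    by (intro antisym shape_upper_bound shape_lower_bound assms st)
qed

end
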